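(* Let $n\ge 1$, let $G=(V,E)$ be a graph on $n$ vertices, let $H_C=\sum_{\langle i,j\rangle\in E}\sigma^z_i\sigma^z_j$ and $H_B=-\sum_{i=1}^n\sigma^x_i$ acting on $(\mathbb{C}^2)^{\otimes n}$. For $q\ge 1$ and $(\boldsymbol\beta,\boldsymbol\gamma)\in\mathbb{R}^q\times\mathbb{R}^q$ define $$|\boldsymbol\beta,\boldsymbol\gamma\rangle = e^{-\mathrm{i}\beta_q H_B}e^{-\mathrm{i}\gamma_q H_C}\cdots e^{-\mathrm{i}\beta_1 H_B}e^{-\mathrm{i}\gamma_1 H_C}\,|+\rangle^{\otimes n},\qquad E_q(\boldsymbol\beta,\boldsymbol\gamma)=\langle\boldsymbol\beta,\boldsymbol\gamma|H_C|\boldsymbol\beta,\boldsymbol\gamma\rangle .$$ Let $p\ge 1$ and let $\boldsymbol\Gamma^p_{\min}=(\beta_1^\star,\ldots,\beta_p^\star,\gamma_1^\star,\ldots,\gamma_p^\star)$ be a local minimum of $E_p:\mathbb{R}^{2p}\to\mathbb{R}$. For $i\in[1,p+1]$ and $j\in\{i,i+1\}$ with $j\le p+1$, define the point of $\mathbb{R}^{2(p+1)}$ $$\boldsymbol\Gamma^{p+1}_{\mathrm{TS}}(i,j)=(\beta_1^\star,\ldots,\beta_{i-1}^\star,0,\beta_i^\star,\ldots,\beta_p^\star,\ \gamma_1^\star,\ldots,\gamma_{j-1}^\star,0,\gamma_j^\star,\ldots,\gamma_p^\star),$$ i.e. a zero is inserted at position $i$ of the $\beta$-vector and at position $j$ of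 the $\gamma$-vector (these are $2p+1$ points). Then each of these $2p+1$ points is either (i) a transition state of $E_{p+1}$, or (ii) a point at which the Hessian of $E_{p+1}$ is singular.
   Context: $|+\rangle=(|0\rangle+|1\rangle)/\sqrt2$ and $\sigma^x_i,\sigma^z_i$ are the Pauli matrices acting on the $i$-th qubit. The first $q$ coordinates of a point in $\mathbb{R}^{2q}$ are $\beta_1,\ldots,\beta_q$ and the last $q$ are $\gamma_1,\ldots,\gamma_q$. A transition state of a smooth function $F:\mathbb{R}^m\to\mathbb{R}$ is a stationary point ($\nabla F=0$) at which the Hessian matrix $\partial_a\partial_b F$ has exactly one negative eigenvalue and all other eigenvalues positive. *)

theory Defs
  imports Complex_Main "Jordan_Normal_Form.Char_Poly" "Jordan_Normal_Form.Determinant"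
begin

text \<open>The Hilbert space of n qubits is C^(2^n); basis index r < 2^n, and qubit i
  (0 \<le> i < n) is bit i of r.\<close>

definition dimq :: "nat \<Rightarrow> nat" where "dimq n = 2 ^ n"

definition sigma_x :: "nat \<Rightarrow> nat \<Rightarrow> complex mat" where
  "sigma_x n i = mat (dimq n) (dimq n) (\<lambda>(r, c). if c = flip_bit i r then 1 else 0)"

definition sigma_z :: "nat \<Rightarrow> nat \<Rightarrow> complex mat" where
  "sigma_z n i = mat (dimq n) (dimq n) (\<lambda>(r, c). if r = c then (if bit r i then -1 else 1) else 0)"

text \<open>Cost Hamiltonian H_C = sum over edges of sigma^z_i sigma^z_j (edges as pairs (i,j) with i<j<n).\<close>
definition H_C :: "nat \<Rightarrow> (nat \<times> nat) set \<Rightarrow> complex mat" where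
  "H_C n E = mat (dimq n) (dimq n)
     (\<lambda>(r, c). \<Sum>(i, j)\<in>E. (sigma_z n i * sigma_z n j) $$ (r, c))"

definition H_B :: "nat \<Rightarrow> complex mat" where
  "H_B n = mat (dimq n) (dimq n) (\<lambda>(r, c). - (\<Sum>i<n. sigma_x n i $$ (r, c)))"

definition exp_mat :: "complex mat \<Rightarrow> complex mat" where
  "exp_mat A = mat (dim_row A) (dim_col A)
     (\<lambda>(r, c). \<Sum>k. (A ^\<^sub>m k) $$ (r, c) / of_nat (fact k))"

definition plus_state :: "nat \<Rightarrow> complex vec" where
  "plus_state n = vec (dimq n) (\<lambda>_. complex_of_real (1 / sqrt (2 ^ n)))"

text \<open>Points of R^(2q) are real lists xs of length 2q; beta_k = xs!(k-1),
  gamma_k = xs!(q+k-1) for k = 1..q.\<close>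

fun qaoa_layers :: "nat \<Rightarrow> (nat \<times> nat) set \<Rightarrow> nat \<Rightarrow> real list \<Rightarrow> nat \<Rightarrow> complex vec" where
  "qaoa_layers n E q xs 0 = plus_state n"
| "qaoa_layers n E q xs (Suc k) =
     exp_mat ((- \<i> * complex_of_real (xs ! k)) \<cdot>\<^sub>m H_B n) *\<^sub>v
     (exp_mat ((- \<i> * complex_of_real (xs ! (q + k))) \<cdot>\<^sub>m H_C n E) *\<^sub>v
       qaoa_layers n E q xs k)"

definition qaoa_state :: "nat \<Rightarrow> (nat \<times> nat) set \<Rightarrow> nat \<Rightarrow> real list \<Rightarrow> complex vec" where
  "qaoa_state n E q xs = qaoa_layers n E q xs q"

text \<open>E_q(beta,gamma) = <beta,gamma| H_C |beta,gamma> (a real number; we take its real part).\<close>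
definition qaoa_energy :: "nat \<Rightarrow> (nat \<times> nat) set \<Rightarrow> nat \<Rightarrow> real list \<Rightarrow> real" where
  "qaoa_energy n E q xs =
     (let psi = qaoa_state n E q xs
      in Re (\<Sum>r<dimq n. cnj (psi $ r) * ((H_C n E *\<^sub>v psi) $ r)))"

definition partial :: "(real list \<Rightarrow> real) \<Rightarrow> nat \<Rightarrow> real list \<Rightarrow> real" where
  "partial F a xs = (THE D. ((\<lambda>t. F (xs[a := t])) has_real_derivative D) (at (xs ! a)))"

definition hessian :: "(real list \<Rightarrow> real) \<Rightarrow> nat \<Rightarrow> real list \<Rightarrow> real mat" where
  "hessian F m xs = mat m m (\<lambda>(a, b). partial (partial F b) a xs)"

definition stationary :: "(real list \<Rightarrow> real) \<Rightarrow> nat \<Rightarrow> real list \<Rightarrow> bool" where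
  "stationary F m xs \<longleftrightarrow> (\<forall>a<m. partial F a xs = 0)"

definition eigenvalues_mset :: "real mat \<Rightarrow> complex multiset" where
  "eigenvalues_mset M = proots (char_poly (map_mat complex_of_real M))"

definition transition_state :: "(real list \<Rightarrow> real) \<Rightarrow> nat \<Rightarrow> real list \<Rightarrow> bool" where
  "transition_state F m xs \<longleftrightarrow> stationary F m xs \<and>
     (\<exists>l M. l < 0 \<and> eigenvalues_mset (hessian F m xs) = add_mset (complex_of_real l) M \<and>
            (\<forall>z \<in># M. z \<in> \<real> \<and> Re z > 0))"

definition local_min :: "(real list \<Rightarrow> real) \<Rightarrow> nat \<Rightarrow> real list \<Rightarrow> bool" where
  "local_min F m xs \<longleftrightarrow> length xs = m \<and>
     (\<exists>e>0. \<forall>ys. length ys = m \<and> sqrt (\<Sum>a<m. (ys ! a - xs ! a)^2) < e \<longrightarrow> F xs \<le> F ys)"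

definition insert_at :: "nat \<Rightarrow> real list \<Rightarrow> real list" where
  "insert_at i ys = take (i - 1) ys @ 0 # drop (i - 1) ys"

definition ts_point :: "nat \<Rightarrow> real list \<Rightarrow> nat \<Rightarrow> nat \<Rightarrow> real list" where
  "ts_point p xs i j = insert_at i (take p xs) @ insert_at j (drop p xs)"

end

theory Submission
  imports Defs "Jordan_Normal_Form.Schur_Decomposition" "HOL-Analysis.Function_Topology"
begin

text \<open>
  Inserting \<open>\<beta>\<^sub>b = 0\<close> next to \<open>\<gamma>\<^sub>g = 0\<close> makes two layers mergeable: while \<open>\<gamma>\<^sub>g = 0\<close>, the energy depends on
  \<open>\<beta>\<^sub>b\<close> and a neighbouring \<open>\<beta>\<close> only through their sum, so it is constant along a direction \<open>v\<close>;
  while \<open>\<beta>\<^sub>b = 0\<close> it is likewise constant along a direction \<open>w\<close> of \<open>\<gamma>\<close> parameters. (At the two ends of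
  the circuit, the uniform state and the cost Hamiltonian absorb the extra layer.) Differentiating
  these invariances gives stationarity and \<open>H v = \<kappa> e\<^sub>g\<close>, \<open>H w = \<kappa> e\<^sub>b\<close> for the Hessian \<open>H\<close>, so \<open>H\<close> is
  congruent to the direct sum of the positive semidefinite Hessian of \<open>E\<^sub>p\<close> and a hyperbolic plane.
  If \<open>H\<close> is nonsingular, then \<open>\<kappa> \<noteq> 0\<close>, \<open>H\<close> takes a negative value, and it is nonnegative on a
  hyperplane; hence it has exactly one negative eigenvalue.
\<close>

section \<open>Symmetric matrices that are nonnegative on a hyperplane\<close>

definition qform :: "nat \<Rightarrow> (nat \<Rightarrow> nat \<Rightarrow> real) \<Rightarrow> (nat \<Rightarrow> real) \<Rightarrow> real" where
  "qform N H y = (\<Sum>a<N. \<Sum>b<N. y a * H a b * y b)"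

lemma qform_add:
  assumes sym: "\<And>a b. a < N \<Longrightarrow> b < N \<Longrightarrow> H a b = H b a"
  shows "qform N H (\<lambda>a. u a + s * z a) =
    qform N H u + 2 * s * (\<Sum>a<N. z a * (\<Sum>b<N. H a b * u b)) + s^2 * qform N H z"
proof -
  have "(\<Sum>a<N. \<Sum>b<N. u a * H a b * z b) = (\<Sum>a<N. \<Sum>b<N. z a * H a b * u b)"
    by (subst sum.swap) (auto intro!: sum.cong simp: sym)
  moreover have "qform N H (\<lambda>a. u a + s * z a) = qform N H u
     + s * (\<Sum>a<N. \<Sum>b<N. u a * H a b * z b) + s * (\<Sum>a<N. \<Sum>b<N. z a * H a b * u b)
     + s^2 * qform N H z"
  proof -
    have "qform N H (\<lambda>a. u a + s * z a) = (\<Sum>a<N. \<Sum>b<N. u a * H a b * u b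
        + s * (u a * H a b * z b) + s * (z a * H a b * u b) + s^2 * (z a * H a b * z b))"
      unfolding qform_def by (intro sum.cong refl) (simp add: algebra_simps power2_eq_square)
    then show ?thesis by (simp add: qform_def sum.distrib sum_distrib_left)
  qed
  ultimately show ?thesis
    by (simp add: sum_distrib_left mult.assoc)
qed

text \<open>For small \<open>s\<close> of sign opposite to \<open>c\<close> the linear term
  dominates the quadratic one.\<close>

lemma quadratic_nonneg_imp_linear_zero:
  fixes c d :: real
  assumes "\<And>s. 0 \<le> 2 * s * c + s^2 * d"
  shows "c = 0"
proof (rule ccontr)
  assume "c \<noteq> 0"
  \<comment> \<open>As \<open>k\<close> is positive and exceeds \<open>d\<close>, the expression at
    \<open>s = - c / k\<close> is \<open>c^2 / k\<close> times the negative number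
    \<open>d / k - 2\<close>.\<close>
  define k where "k = \<bar>d\<bar> + 1"
  have k: "k > 0" "d < k" unfolding k_def by auto
  have "0 \<le> 2 * (- c / k) * c + (- c / k)^2 * d" by (rule assms)
  also have "\<dots> = (c^2 / k) * (d / k - 2)"
    using k by (simp add: field_simps power2_eq_square)
  also have "\<dots> < 0"
    using k \<open>c \<noteq> 0\<close> by (intro mult_pos_neg divide_pos_pos) (auto simp: field_simps)
  finally show False by simp
qed

text \<open>Vectors are functions on all naturals, so the coordinates from \<open>N\<close> on are
  pinned to 0; the sphere is then a closed subset of a product of compact sets.\<close>

lemma compact_unit_sphere_fun:
  "compact {y :: nat \<Rightarrow> real. (\<forall>a\<ge>N. y a = 0) \<and> (\<Sum>a<N. (y a)^2) = 1}" (is "compact ?S")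
proof -
  define B where "B = PiE UNIV (\<lambda>a. if a < N then {-1..1::real} else {0})"
  have "compactin (product_topology (\<lambda>_. euclidean) UNIV) B"
    unfolding B_def by (subst compactin_PiE) auto
  then have B: "compact B" by (simp add: euclidean_product_topology)
  have C: "closed {y :: nat \<Rightarrow> real. (\<Sum>a<N. (y a)^2) = 1}"
    by (intro closed_Collect_eq continuous_intros)
       (auto intro: continuous_on_product_coordinates)
  have "?S = B \<inter> {y. (\<Sum>a<N. (y a)^2) = 1}"
  proof (intro Set.set_eqI iffI)
    fix y assume y: "y \<in> ?S"
    have "\<bar>y a\<bar> \<le> 1" if "a < N" for a
    proof -
      have "(y a)^2 \<le> (\<Sum>a<N. (y a)^2)" using that by (intro member_le_sum) auto
      then show ?thesis using y by (simp add: abs_square_le_1)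
    qed
    with y show "y \<in> B \<inter> {y. (\<Sum>a<N. (y a)^2) = 1}"
      by (auto simp: B_def PiE_def Pi_def abs_le_iff)
  next
    fix y assume "y \<in> B \<inter> {y. (\<Sum>a<N. (y a)^2) = 1}"
    then show "y \<in> ?S"
      by (auto simp: B_def PiE_def Pi_def split: if_splits) (metis not_less singletonD)
  qed
  with B C show ?thesis by (simp add: compact_Int_closed)
qed

text \<open>The minimiser of the Rayleigh quotient is an eigenvector.\<close>

lemma exists_negative_eigenvector:
  fixes H :: "nat \<Rightarrow> nat \<Rightarrow> real"
  assumes sym: "\<And>a b. a < N \<Longrightarrow> b < N \<Longrightarrow> H a b = H b a"
    and neg: "qform N H y < 0"
  obtains l u a where "l < 0" "a < N" "u a \<noteq> 0"
    "\<forall>a<N. (\<Sum>b<N. H a b * u b) = l * u a"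
proof -
  define S where "S = {y :: nat \<Rightarrow> real. (\<forall>a\<ge>N. y a = 0) \<and> (\<Sum>a<N. (y a)^2) = 1}"
  define sq where "sq z = (\<Sum>a<N. (z a)^2)" for z :: "nat \<Rightarrow> real"
  have sq0: "qform N H z = 0" if "sq z = 0" for z
  proof -
    from that have "z a = 0" if "a < N" for a
      using that unfolding sq_def by (subst (asm) sum_nonneg_eq_0_iff) auto
    then show ?thesis by (simp add: qform_def)
  qed
  \<comment> \<open>Normalising also truncates to the coordinates below \<open>N\<close>, which are
    the only ones that \<open>qform\<close> reads.\<close>
  define nrm where "nrm z = (\<lambda>a. if a < N then z a / sqrt (sq z) else 0)" for z :: "nat \<Rightarrow> real"
  have sq_ge: "sq z \<ge> 0" for z unfolding sq_def by (simp add: sum_nonneg)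
  have nrm: "nrm z \<in> S" "qform N H (nrm z) = qform N H z / sq z" if "sq z \<noteq> 0" for z
  proof -
    have pos: "sq z > 0" using that sq_ge[of z] by simp
    have "(\<Sum>a<N. (nrm z a)^2) = (\<Sum>a<N. (z a)^2 / sq z)"
      by (intro sum.cong) (auto simp: nrm_def power_divide sq_ge)
    also have "\<dots> = 1" using that by (simp add: sq_def flip: sum_divide_distrib)
    finally show "nrm z \<in> S" by (simp add: S_def nrm_def)
    have "qform N H (nrm z) = (\<Sum>a<N. \<Sum>b<N. z a * H a b * z b / sq z)"
      unfolding qform_def
      by (intro sum.cong refl) (use pos in \<open>auto simp: nrm_def field_simps\<close>)
    then show "qform N H (nrm z) = qform N H z / sq z"
      by (simp add: qform_def flip: sum_divide_distrib)
  qed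
  have y: "sq y \<noteq> 0" using sq0[of y] neg by auto
  have "continuous_on S (qform N H)"
    unfolding qform_def
    by (intro continuous_intros continuous_on_subset[OF continuous_on_product_coordinates]) auto
  moreover have "S \<noteq> {}" using nrm(1)[OF y] by auto
  ultimately obtain u where u: "u \<in> S" and min: "\<And>z. z \<in> S \<Longrightarrow> qform N H u \<le> qform N H z"
    using continuous_attains_inf[of S "qform N H"] compact_unit_sphere_fun[of N]
    unfolding S_def by auto
  define l where "l = qform N H u"
  have "l \<le> qform N H y / sq y" using min[OF nrm(1)[OF y]] nrm(2)[OF y] by (simp add: l_def)
  also have "\<dots> < 0" using neg y sq_ge[of y] by (simp add: divide_neg_pos)
  finally have l: "l < 0" .
  have su: "sq u = 1" using u by (simp add: S_def sq_def)
  \<comment> \<open>By homogeneity the minimum on the sphere bounds the form on all vectors.\<close>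
  have ge: "l * sq z \<le> qform N H z" for z
  proof (cases "sq z = 0")
    case False
    then have "l \<le> qform N H z / sq z" using min[OF nrm(1)] nrm(2) by (simp add: l_def)
    then show ?thesis using False sq_ge[of z] by (simp add: field_simps)
  qed (use sq0 in auto)
  define K where "K a b = H a b - (if a = b then l else 0)" for a b
  have Ku: "(\<Sum>b<N. K a b * z b) = (\<Sum>b<N. H a b * z b) - l * z a" if "a < N" for a and z :: "nat \<Rightarrow> real"
    using that by (simp add: K_def left_diff_distrib sum_subtractf if_distrib[of "\<lambda>x. x * _"] cong: if_cong)
  have Kq: "qform N K z = qform N H z - l * sq z" for z
  proof -
    have "qform N K z = (\<Sum>a<N. z a * (\<Sum>b<N. K a b * z b))"
      by (simp add: qform_def sum_distrib_left mult.assoc)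
    also have "\<dots> = (\<Sum>a<N. z a * (\<Sum>b<N. H a b * z b) - l * (z a)^2)"
      by (intro sum.cong refl) (simp add: Ku, simp add: algebra_simps power2_eq_square)
    also have "\<dots> = qform N H z - l * sq z"
      by (simp add: qform_def sq_def sum_distrib_left sum_subtractf mult.assoc)
    finally show ?thesis .
  qed
  have Ku0: "(\<Sum>b<N. K a b * u b) = 0" if a: "a < N" for a
  proof -
    \<comment> \<open>Varying \<open>u\<close> along this unit vector isolates component
      \<open>a\<close> of \<open>K u\<close>.\<close>
    define e where "e = (\<lambda>b. if b = a then 1 else (0::real))"
    have "0 \<le> 2 * s * (\<Sum>b<N. e b * (\<Sum>c<N. K b c * u c)) + s^2 * qform N K e" for s
    proof -
      have "0 \<le> qform N K (\<lambda>a. u a + s * e a)"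
        using ge[of "\<lambda>a. u a + s * e a"] by (simp add: Kq)
      also have "\<dots> = qform N K u + 2 * s * (\<Sum>b<N. e b * (\<Sum>c<N. K b c * u c)) + s^2 * qform N K e"
        by (rule qform_add) (auto simp: K_def sym)
      finally show ?thesis by (simp add: Kq su l_def)
    qed
    then have "(\<Sum>b<N. e b * (\<Sum>c<N. K b c * u c)) = 0"
      by (rule quadratic_nonneg_imp_linear_zero)
    then show ?thesis using a by (simp add: e_def if_distrib[of "\<lambda>x. x * _"] cong: if_cong)
  qed
  obtain a where "a < N" "u a \<noteq> 0"
  proof -
    have "\<exists>a<N. u a \<noteq> 0" using su by (rule_tac ccontr) (auto simp: sq_def)
    then show ?thesis using that by blast
  qed
  then show ?thesis using that[OF l, of a u] Ku0 by (simp add: Ku)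
qed

section \<open>Complex vectors under a real symmetric matrix\<close>

text \<open>Real and imaginary parts contribute separately, so a sign condition on real vectors can
  be applied to complex ones.\<close>

lemma re_hermitian_form:
  fixes H :: "nat \<Rightarrow> nat \<Rightarrow> real" and z :: "nat \<Rightarrow> complex"
  shows "Re (\<Sum>a<N. cnj (z a) * (\<Sum>b<N. of_real (H a b) * z b)) =
    qform N H (\<lambda>a. Re (z a)) + qform N H (\<lambda>a. Im (z a))"
proof -
  have "Re (\<Sum>a<N. cnj (z a) * (\<Sum>b<N. of_real (H a b) * z b)) =
      (\<Sum>a<N. \<Sum>b<N. Re (z a) * H a b * Re (z b) + Im (z a) * H a b * Im (z b))"
    by (simp add: sum_distrib_left sum.distrib algebra_simps)
  then show ?thesis by (simp add: qform_def sum.distrib)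
qed

lemma hermitian_adjoint:
  fixes H :: "nat \<Rightarrow> nat \<Rightarrow> real" and z :: "nat \<Rightarrow> complex"
  assumes sym: "\<And>a b. a < N \<Longrightarrow> b < N \<Longrightarrow> H a b = H b a"
  shows "(\<Sum>a<N. cnj (w a) * (\<Sum>b<N. of_real (H a b) * z b)) =
    (\<Sum>a<N. cnj (\<Sum>b<N. of_real (H a b) * w b) * z a)"
  by (simp add: sum_distrib_left sum_distrib_right, subst sum.swap)
     (auto intro!: sum.cong simp: sym)

lemma sum_cnj_mult_self:
  "(\<Sum>a<(N::nat). cnj (z a) * z a) = of_real (\<Sum>a<N. (norm (z a))^2)"
  by (simp add: complex_norm_square mult.commute del: of_real_power)

text \<open>An invariant plane on which the form is negative definite meets every hyperplane.\<close>

lemma no_negative_invariant_plane: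
  fixes H :: "nat \<Rightarrow> nat \<Rightarrow> real" and f :: "nat \<Rightarrow> real" and p r :: "nat \<Rightarrow> complex"
  assumes sym: "\<And>a b. a < N \<Longrightarrow> b < N \<Longrightarrow> H a b = H b a"
    and nn: "\<And>y. (\<Sum>a<N. f a * y a) = 0 \<Longrightarrow> 0 \<le> qform N H y"
    and e1: "\<And>a. a < N \<Longrightarrow> (\<Sum>b<N. of_real (H a b) * p b) = of_real l1 * p a"
    and e2: "\<And>a. a < N \<Longrightarrow> (\<Sum>b<N. of_real (H a b) * r b) = c * p a + of_real l2 * r a"
    and l: "l1 < 0" "l2 < 0"
    and p: "\<exists>a<N. p a \<noteq> 0" and r: "\<And>t. \<exists>a<N. r a \<noteq> t * p a"
  shows False
proof -
  define ip where "ip w z = (\<Sum>a<N. cnj (w a) * z a)" for w z :: "nat \<Rightarrow> complex"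
  have ip_self: "ip z z = of_real (\<Sum>a<N. (norm (z a))^2)" for z
    unfolding ip_def by (rule sum_cnj_mult_self)
  have ip_pos: "\<exists>P>0. ip z z = of_real P" if "\<exists>a<N. z a \<noteq> 0" for z
  proof -
    have "(\<Sum>a<N. (norm (z a))^2) > 0" using that by (auto intro: sum_pos2)
    with ip_self show ?thesis by blast
  qed
  obtain P where P: "P > 0" "ip p p = of_real P" using ip_pos[OF p] by blast
  \<comment> \<open>Gram-Schmidt: \<open>s\<close> is \<open>r\<close> minus its projection on
    \<open>p\<close>.\<close>
  define t where "t = ip p r / ip p p"
  define s where "s a = r a - t * p a" for a
  have "\<exists>a<N. s a \<noteq> 0" using r[of t] by (auto simp: s_def)
  from ip_pos[OF this] obtain S where S: "S > 0" "ip s s = of_real S" by blast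
  have "ip p s = ip p r - t * ip p p"
    by (simp add: ip_def s_def right_diff_distrib sum_distrib_left sum_subtractf mult_ac)
  then have ps: "ip p s = 0" using P by (simp add: t_def)
  then have sp: "ip s p = 0"
  proof -
    have "ip s p = cnj (ip p s)" by (simp add: ip_def mult.commute)
    with ps show ?thesis by simp
  qed
  \<comment> \<open>\<open>d\<close> is the coefficient of \<open>p\<close> in \<open>H s\<close>.
    Pairing \<open>H s\<close> with \<open>p\<close> and moving \<open>H\<close> across gives
    \<open>d = 0\<close>, so \<open>s\<close> is an eigenvector too.\<close>
  define d where "d = c + of_real l2 * t - t * of_real l1"
  have Hs: "(\<Sum>b<N. of_real (H a b) * s b) = d * p a + of_real l2 * s a" if "a < N" for a
  proof -
    have "(\<Sum>b<N. of_real (H a b) * s b) =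
       (\<Sum>b<N. of_real (H a b) * r b) - t * (\<Sum>b<N. of_real (H a b) * p b)"
      by (simp add: s_def right_diff_distrib sum_distrib_left sum_subtractf mult_ac)
    also have "\<dots> = c * p a + of_real l2 * r a - t * (of_real l1 * p a)"
      by (simp add: e1 e2 that)
    also have "\<dots> = d * p a + of_real l2 * s a"
      by (simp add: s_def d_def algebra_simps)
    finally show ?thesis .
  qed
  have "d * of_real P = ip p (\<lambda>a. \<Sum>b<N. of_real (H a b) * s b)"
  proof -
    have "ip p (\<lambda>a. \<Sum>b<N. of_real (H a b) * s b) = ip p (\<lambda>a. d * p a + of_real l2 * s a)"
      unfolding ip_def by (intro sum.cong) (auto simp: Hs)
    also have "\<dots> = d * ip p p + of_real l2 * ip p s"
      by (simp add: ip_def ring_distribs sum_distrib_left sum.distrib mult_ac)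
    finally show ?thesis by (simp add: P ps)
  qed
  also have "\<dots> = ip (\<lambda>a. \<Sum>b<N. of_real (H a b) * p b) s"
    unfolding ip_def by (rule hermitian_adjoint[OF sym])
  also have "\<dots> = ip (\<lambda>a. of_real l1 * p a) s"
    unfolding ip_def by (intro sum.cong refl) (simp only: e1 lessThan_iff)
  also have "\<dots> = of_real l1 * ip p s"
    by (simp add: ip_def sum_distrib_left mult_ac)
  finally have d: "d = 0" using P ps by simp
  define fp where "fp = (\<Sum>a<N. of_real (f a) * p a)"
  define fs where "fs = (\<Sum>a<N. of_real (f a) * s a)"
  \<comment> \<open>One linear equation on the plane spanned by \<open>p\<close> and
    \<open>s\<close> has a nonzero solution.\<close>
  obtain x y where xy: "x \<noteq> 0 \<or> y \<noteq> 0" "x * fp + y * fs = 0"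
  proof (cases "fp = 0")
    case True then show ?thesis using that[of 1 0] by simp
  next
    case False then show ?thesis using that[of fs "- fp"] by (simp add: algebra_simps)
  qed
  define z where "z a = x * p a + y * s a" for a
  have fz: "(\<Sum>a<N. of_real (f a) * z a) = 0"
    using xy(2) by (simp add: z_def fp_def fs_def ring_distribs sum_distrib_left sum.distrib mult_ac)
  \<comment> \<open>Since \<open>f\<close> is real, both the real and the imaginary part of
    \<open>z\<close> lie in the hyperplane. The form is thus nonnegative at \<open>z\<close>, while
    the expansion in orthogonal eigenvectors makes it negative.\<close>
  have "(\<Sum>a<N. f a * Re (z a)) = Re (\<Sum>a<N. of_real (f a) * z a)"
       "(\<Sum>a<N. f a * Im (z a)) = Im (\<Sum>a<N. of_real (f a) * z a)" by simp_all
  with fz have "0 \<le> qform N H (\<lambda>a. Re (z a))" "0 \<le> qform N H (\<lambda>a. Im (z a))"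
    by (auto intro!: nn)
  then have "0 \<le> Re (ip z (\<lambda>a. \<Sum>b<N. of_real (H a b) * z b))"
    unfolding ip_def by (subst re_hermitian_form) simp
  also have "ip z (\<lambda>a. \<Sum>b<N. of_real (H a b) * z b) =
      ip z (\<lambda>a. x * of_real l1 * p a + y * of_real l2 * s a)"
  proof -
    have "(\<Sum>b<N. of_real (H a b) * z b) = x * of_real l1 * p a + y * of_real l2 * s a" if "a < N" for a
    proof -
      have "(\<Sum>b<N. of_real (H a b) * z b) =
         x * (\<Sum>b<N. of_real (H a b) * p b) + y * (\<Sum>b<N. of_real (H a b) * s b)"
        by (simp add: z_def ring_distribs sum_distrib_left sum.distrib mult_ac)
      then show ?thesis by (simp add: e1 Hs d that)
    qed
    then show ?thesis unfolding ip_def by (intro sum.cong) auto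
  qed
  also have "\<dots> = cnj x * x * of_real l1 * ip p p + cnj y * y * of_real l2 * ip s s
      + cnj x * y * of_real l2 * ip p s + cnj y * x * of_real l1 * ip s p"
    by (simp add: ip_def z_def ring_distribs sum_distrib_left sum.distrib mult_ac)
  also have "\<dots> = of_real ((norm x)^2 * l1 * P + (norm y)^2 * l2 * S)"
    by (simp add: ps sp P S complex_norm_square mult.commute del: of_real_power)
  finally have "0 \<le> (norm x)^2 * l1 * P + (norm y)^2 * l2 * S" by simp
  moreover have "(norm x)^2 * l1 * P \<le> 0" "(norm y)^2 * l2 * S \<le> 0"
    by (rule mult_nonpos_nonneg[OF mult_nonneg_nonpos]; use l P S in simp)+
  moreover have "(norm x)^2 * l1 * P < 0 \<or> (norm y)^2 * l2 * S < 0"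
    using xy(1) l P S by (auto simp: mult_less_0_iff zero_less_mult_iff)
  ultimately show False by linarith
qed

section \<open>Eigenvalues with multiplicity\<close>

lemma map_mat_of_real_mult_vec_index:
  assumes "H \<in> carrier_mat N N" "dim_vec v = N" "a < N"
  shows "(map_mat of_real H *\<^sub>v v) $ a = (\<Sum>b<N. of_real (H $$ (a, b)) * v $ b)"
  using assms by (auto simp: scalar_prod_def atLeast0LessThan intro!: sum.cong)

lemma proots_prod_linear:
  "proots (\<Prod>e\<leftarrow>es. [:- e, 1:]) = mset (es :: complex list)"
proof (induct es)
  case (Cons e es)
  have "(\<Prod>e\<leftarrow>es. [:- e, 1:]) \<noteq> 0" by (auto simp: prod_list_zero_iff)
  then have "proots ([:- e, 1:] * (\<Prod>e\<leftarrow>es. [:- e, 1:])) = proots [:- e, 1:] + proots (\<Prod>e\<leftarrow>es. [:- e, 1:])"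
    by (intro proots_mult) auto
  with Cons show ?case by simp
qed simp

text \<open>Self-adjointness makes the eigenvalues real, the determinant makes them nonzero, and
  minimisation supplies a negative one. A second negative root would yield an invariant plane
  excluded by \<open>no_negative_invariant_plane\<close>.\<close>

lemma one_negative_eigenvalue:
  fixes H :: "real mat" and f :: "nat \<Rightarrow> real"
  assumes H: "H \<in> carrier_mat N N"
    and sym: "\<And>a b. a < N \<Longrightarrow> b < N \<Longrightarrow> H $$ (a, b) = H $$ (b, a)"
    and det: "det H \<noteq> 0"
    and nn: "\<And>y. (\<Sum>a<N. f a * y a) = 0 \<Longrightarrow> 0 \<le> qform N (\<lambda>a b. H $$ (a, b)) y"
    and neg: "qform N (\<lambda>a b. H $$ (a, b)) y < 0"
  shows "\<exists>l M. l < 0 \<and> eigenvalues_mset H = add_mset (complex_of_real l) M \<and>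
            (\<forall>z \<in># M. z \<in> \<real> \<and> Re z > 0)"
proof -
  define A where "A = map_mat complex_of_real H"
  have A: "A \<in> carrier_mat N N" using H by (simp add: A_def)
  obtain es where es: "char_poly A = (\<Prod>e\<leftarrow>es. [:- e, 1:])"
    using char_poly_factorized[OF A] by blast
  have ev: "eigenvalues_mset H = mset es"
    unfolding eigenvalues_mset_def A_def[symmetric] es by (rule proots_prod_linear)
  have root: "z \<in> set es \<longleftrightarrow> eigenvalue A z" for z
    unfolding eigenvalue_root_char_poly[OF A] es poly_prod_list prod_list_zero_iff by auto
  have real: "z \<in> \<real> \<and> z \<noteq> 0" if "z \<in> set es" for z
  proof -
    from that obtain v where v: "v \<in> carrier_vec N" "v \<noteq> 0\<^sub>v N" "A *\<^sub>v v = z \<cdot>\<^sub>v v"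
      using A by (auto simp: root eigenvalue_def eigenvector_def)
    have Av: "(\<Sum>b<N. of_real (H $$ (a, b)) * v $ b) = z * v $ a" if "a < N" for a
      using v that map_mat_of_real_mult_vec_index[OF H _ that, of v]
      by (auto simp: A_def)
    have nz: "\<exists>a<N. v $ a \<noteq> 0" using v(1,2) by (metis carrier_vecD eq_vecI index_zero_vec)
    define P where "P = (\<Sum>a<N. (norm (v $ a))^2)"
    have P: "P > 0" unfolding P_def using nz by (auto intro: sum_pos2)
    have PP: "of_real P = (\<Sum>a<N. cnj (v $ a) * v $ a)"
      unfolding P_def by (rule sum_cnj_mult_self[symmetric])
    \<comment> \<open>Moving \<open>A\<close> across the Hermitian product of \<open>v\<close> with
      \<open>A v\<close> turns \<open>z\<close> into its conjugate.\<close>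
    have "z * of_real P = (\<Sum>a<N. cnj (v $ a) * (z * v $ a))"
      by (simp add: PP sum_distrib_left mult_ac)
    also have "\<dots> = (\<Sum>a<N. cnj (v $ a) * (\<Sum>b<N. of_real (H $$ (a, b)) * v $ b))"
      by (simp add: Av)
    also have "\<dots> = (\<Sum>a<N. cnj (\<Sum>b<N. of_real (H $$ (a, b)) * v $ b) * v $ a)"
      by (rule hermitian_adjoint[OF sym])
    also have "\<dots> = (\<Sum>a<N. cnj (z * v $ a) * v $ a)"
      by (intro sum.cong refl) (simp only: Av lessThan_iff)
    also have "\<dots> = cnj z * of_real P"
      by (simp add: PP sum_distrib_left mult_ac)
    finally have "z = cnj z" using P by simp
    then have "z \<in> \<real>" by (simp add: Reals_cnj_iff)
    moreover have "z \<noteq> 0"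
    proof
      assume "z = 0"
      then have "A *\<^sub>v v = 0\<^sub>v N" using v by auto
      then have "det A = 0" using det_0_iff_vec_prod_zero[OF A] v by blast
      moreover have "det A = of_real (det H)" by (simp add: A_def)
      ultimately show False using det by simp
    qed
    ultimately show ?thesis by blast
  qed
  obtain l u a where l: "l < 0" "a < N" "u a \<noteq> 0"
    "\<forall>a<N. (\<Sum>b<N. H $$ (a, b) * u b) = l * u a"
    by (rule exists_negative_eigenvector[OF sym neg])
  define v where "v = vec N (\<lambda>a. complex_of_real (u a))"
  have "(A *\<^sub>v v) $ a = of_real l * v $ a" if "a < N" for a
  proof -
    have "(A *\<^sub>v v) $ a = of_real (\<Sum>b<N. H $$ (a, b) * u b)"
      unfolding A_def
      by (subst map_mat_of_real_mult_vec_index[OF H _ that]) (auto simp: v_def)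
    then show ?thesis using that by (simp add: l v_def)
  qed
  then have "A *\<^sub>v v = of_real l \<cdot>\<^sub>v v" using A by (intro eq_vecI) (auto simp: v_def)
  moreover have "v \<noteq> 0\<^sub>v N" using l by (auto simp: v_def dest!: arg_cong[of _ _ "\<lambda>v. v $ a"])
  moreover have "v \<in> carrier_vec N" by (simp add: v_def)
  ultimately have "eigenvalue A (of_real l)"
    using A unfolding eigenvalue_def eigenvector_def by auto
  then have "of_real l \<in># mset es" by (simp add: root)
  then obtain M where M: "mset es = add_mset (of_real l) M" by (meson mset_add)
  have "z \<in> \<real> \<and> Re z > 0" if z: "z \<in># M" for z
  proof (rule ccontr)
    assume contra: "\<not> (z \<in> \<real> \<and> Re z > 0)"
    from z M have "z \<in> set es" by (metis set_mset_mset union_iff insert_iff set_mset_add_mset_insert)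
    from real[OF this] have zr: "z \<in> \<real>" "z \<noteq> 0" by auto
    then obtain m where m: "z = of_real m" by (auto elim: Reals_cases)
    with zr contra have m0: "m < 0" by auto
    obtain M' where "M = add_mset z M'" using z by (meson mset_add)
    moreover obtain es' where "mset es' = M'" using ex_mset by blast
    ultimately have perm: "mset es = mset (of_real l # of_real m # es')" using M m by simp
    have "char_poly A = prod_mset (image_mset (\<lambda>e. [:- e, 1:]) (mset es))"
      by (simp add: es flip: mset_map prod_mset_prod_list)
    also have "\<dots> = (\<Prod>e\<leftarrow>of_real l # of_real m # es'. [:- e, 1:])"
      unfolding perm by (simp flip: mset_map prod_mset_prod_list)
    finally have cp: "char_poly A = (\<Prod>e\<leftarrow>of_real l # of_real m # es'. [:- e, 1:])" .
    \<comment> \<open>The Schur form has the eigenvalues on the diagonal in the given order, so the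
      first two columns of \<open>P\<close> span an invariant plane for the two negative ones. This
      works for a repeated eigenvalue as well.\<close>
    obtain B P Q where BPQ: "schur_decomposition A (of_real l # of_real m # es') = (B, P, Q)"
      by (metis prod_cases3)
    from schur_decomposition[OF A cp BPQ] have sw: "similar_mat_wit A B P Q"
      and ut: "upper_triangular B" and dm: "diag_mat B = of_real l # of_real m # es'" by auto
    note w = similar_mat_witD2[OF A sw]
    have N2: "2 \<le> N" using arg_cong[OF dm, of length] w(5) by (simp add: diag_mat_def)
    have B00: "B $$ (0, 0) = of_real l" and B11: "B $$ (1, 1) = of_real m"
      using arg_cong[OF dm, of "\<lambda>xs. xs ! 0"] arg_cong[OF dm, of "\<lambda>xs. xs ! 1"] w(5) N2
      by (auto simp: diag_mat_def)
    have AP: "A * P = P * B"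
    proof -
      have "A * P = P * B * (Q * P)" unfolding w(3) using w(4-7) by (simp add: assoc_mult_mat[of _ N N _ N _ N])
      then show ?thesis using w by simp
    qed
    have APc: "(\<Sum>b<N. of_real (H $$ (a, b)) * P $$ (b, k)) = (\<Sum>b<N. P $$ (a, b) * B $$ (b, k))"
      if "a < N" "k < N" for a k
    proof -
      have "(A * P) $$ (a, k) = (\<Sum>b<N. of_real (H $$ (a, b)) * P $$ (b, k))"
        using that w(6) H by (auto simp: A_def scalar_prod_def atLeast0LessThan intro!: sum.cong)
      moreover have "(P * B) $$ (a, k) = (\<Sum>b<N. P $$ (a, b) * B $$ (b, k))"
        using that w(5,6) by (auto simp: scalar_prod_def atLeast0LessThan intro!: sum.cong)
      ultimately show ?thesis by (simp add: AP)
    qed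
    have ut': "B $$ (b, k) = 0" if "k < b" "b < N" for b k
      using ut that w(5) by (auto simp: upper_triangular_def)
    have c0: "(\<Sum>b<N. of_real (H $$ (a, b)) * P $$ (b, 0)) = of_real l * P $$ (a, 0)" if "a < N" for a
    proof -
      have "(\<Sum>b<N. P $$ (a, b) * B $$ (b, 0)) = (\<Sum>b\<in>{0}. P $$ (a, b) * B $$ (b, 0))"
        by (rule sum.mono_neutral_right) (use N2 ut' in auto)
      with that N2 show ?thesis by (simp add: APc B00)
    qed
    \<comment> \<open>Column 1 of \<open>P\<close> is an eigenvector only up to a multiple of column
      0, given by the entry of \<open>B\<close> above the diagonal.\<close>
    have c1: "(\<Sum>b<N. of_real (H $$ (a, b)) * P $$ (b, 1)) =
        B $$ (0, 1) * P $$ (a, 0) + of_real m * P $$ (a, 1)" if "a < N" for a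
    proof -
      have "(\<Sum>b<N. P $$ (a, b) * B $$ (b, 1)) = (\<Sum>b\<in>{0,1}. P $$ (a, b) * B $$ (b, 1))"
        by (rule sum.mono_neutral_right) (use N2 ut' in auto)
      with that N2 B11 show ?thesis by (simp add: APc)
    qed
    have QP: "(\<Sum>a<N. Q $$ (i, a) * P $$ (a, k)) = (if i = k then 1 else 0)" if "i < N" "k < N" for i k
    proof -
      have "(Q * P) $$ (i, k) = (\<Sum>a<N. Q $$ (i, a) * P $$ (a, k))"
        using that w(6,7) by (auto simp: scalar_prod_def atLeast0LessThan intro!: sum.cong)
      with that show ?thesis by (simp add: w(2))
    qed
    have p: "\<exists>a<N. P $$ (a, 0) \<noteq> 0"
    proof (rule ccontr)
      assume "\<not> ?thesis"
      then have "(\<Sum>a<N. Q $$ (0, a) * P $$ (a, 0)) = 0" by (intro sum.neutral) auto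
      with QP[of 0 0] N2 show False by simp
    qed
    \<comment> \<open>If column 1 were \<open>t\<close> times column 0, the (1, 1) entry of
      \<open>Q * P\<close> would be \<open>t\<close> times its (1, 0) entry, which is 0.\<close>
    have r: "\<exists>a<N. P $$ (a, 1) \<noteq> t * P $$ (a, 0)" for t
    proof (rule ccontr)
      assume "\<not> ?thesis"
      then have "(\<Sum>a<N. Q $$ (1, a) * P $$ (a, 1)) = (\<Sum>a<N. t * (Q $$ (1, a) * P $$ (a, 0)))"
        by (intro sum.cong) auto
      also have "\<dots> = 0" using QP[of 1 0] N2 by (simp flip: sum_distrib_left)
      finally show False using QP[of 1 1] N2 by simp
    qed
    from no_negative_invariant_plane[OF sym nn c0 c1 l(1) m0 p r] show False by blast
  qed
  with l(1) M ev show ?thesis by metis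
qed

section \<open>Trigonometric polynomials\<close>

text \<open>Pairs of coefficient and frequency vector turn products and derivatives into operations
  on finite lists.\<close>

definition expsum :: "nat \<Rightarrow> (complex \<times> (nat \<Rightarrow> real)) list \<Rightarrow> (nat \<Rightarrow> real) \<Rightarrow> complex" where
  "expsum m L u = (\<Sum>(c, w)\<leftarrow>L. c * cis (\<Sum>a<m. w a * u a))"

definition trig_poly :: "nat \<Rightarrow> ((nat \<Rightarrow> real) \<Rightarrow> complex) \<Rightarrow> bool" where
  "trig_poly m f \<longleftrightarrow> (\<exists>L. \<forall>u. f u = expsum m L u)"

lemma expsum_Nil [simp]: "expsum m [] u = 0"
  and expsum_Cons: "expsum m ((c, w) # L) u = c * cis (\<Sum>a<m. w a * u a) + expsum m L u"
  and expsum_append: "expsum m (L @ M) u = expsum m L u + expsum m M u"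
  by (simp_all add: expsum_def)

lemma expsum_cong: "(\<And>a. a < m \<Longrightarrow> u a = u' a) \<Longrightarrow> expsum m L u = expsum m L u'"
  by (simp add: expsum_def)

lemma trig_poly_const [intro]: "trig_poly m (\<lambda>u. c)"
  unfolding trig_poly_def by (rule exI[of _ "[(c, \<lambda>_. 0)]"]) (simp add: expsum_Cons)

lemma trig_poly_add [intro]:
  assumes "trig_poly m f" "trig_poly m g"
  shows "trig_poly m (\<lambda>u. f u + g u)"
  using assms unfolding trig_poly_def by (metis expsum_append)

lemma trig_poly_sum [intro]:
  assumes "\<And>i. i \<in> I \<Longrightarrow> trig_poly m (f i)"
  shows "trig_poly m (\<lambda>u. \<Sum>i\<in>I. f i u)"
  using assms by (induct I rule: infinite_finite_induct) auto

text \<open>Exponentials multiply by adding frequencies; induction on the first list reduces to one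
  exponential times a sum.\<close>

lemma trig_poly_mult [intro]:
  assumes "trig_poly m f" "trig_poly m g"
  shows "trig_poly m (\<lambda>u. f u * g u)"
proof -
  obtain L M where LM: "\<And>u. f u = expsum m L u" "\<And>u. g u = expsum m M u"
    using assms unfolding trig_poly_def by blast
  have 1: "trig_poly m (\<lambda>u. c * cis (\<Sum>a<m. w a * u a) * expsum m M u)" for c w
    unfolding trig_poly_def
  proof (intro exI allI)
    show "c * cis (\<Sum>a<m. w a * u a) * expsum m M u =
        expsum m (map (\<lambda>(d, v). (c * d, \<lambda>a. w a + v a)) M) u" for u
      by (induct M) (auto simp: expsum_Cons sum.distrib ring_distribs simp flip: cis_mult)
  qed
  have "trig_poly m (\<lambda>u. expsum m L u * expsum m M u)"
    by (induct L) (auto simp: expsum_Cons ring_distribs intro!: 1)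
  with LM show ?thesis by simp
qed

lemma trig_poly_cnj [intro]:
  assumes "trig_poly m f"
  shows "trig_poly m (\<lambda>u. cnj (f u))"
proof -
  obtain L where L: "\<And>u. f u = expsum m L u"
    using assms unfolding trig_poly_def by blast
  have "cnj (expsum m L u) = expsum m (map (\<lambda>(c, w). (cnj c, \<lambda>a. - w a)) L) u" for u
    by (induct L) (auto simp: expsum_Cons cis_cnj sum_negf)
  with L show ?thesis unfolding trig_poly_def by metis
qed

lemma trig_poly_cis:
  assumes "k < m"
  shows "trig_poly m (\<lambda>u. cis (w * u k))"
  unfolding trig_poly_def
  by (rule exI[of _ "[(1, \<lambda>a. if a = k then w else 0)]"])
     (use assms in \<open>simp add: expsum_Cons if_distrib[of "\<lambda>x. x * _"] cong: if_cong\<close>)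

section \<open>Derivatives of trigonometric polynomials\<close>

text \<open>Differentiation in coordinate \<open>b\<close> multiplies each coefficient by the
  imaginary unit times \<open>w b\<close>; second derivatives therefore commute.\<close>

definition dcoeff :: "nat \<Rightarrow> (complex \<times> (nat \<Rightarrow> real)) list \<Rightarrow> (complex \<times> (nat \<Rightarrow> real)) list" where
  "dcoeff b L = map (\<lambda>(c, w). (\<i> * of_real (w b) * c, w)) L"

abbreviation re_expsum :: "nat \<Rightarrow> (complex \<times> (nat \<Rightarrow> real)) list \<Rightarrow> (nat \<Rightarrow> real) \<Rightarrow> real" where
  "re_expsum m L u \<equiv> Re (expsum m L u)"

lemma dcoeff_commute: "dcoeff a (dcoeff b L) = dcoeff b (dcoeff a L)"
  by (auto simp: dcoeff_def)

text \<open>The chain rule on each exponential. Having it at every \<open>t\<close>, with sums of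
  the same kind as derivative, allows it to be applied twice.\<close>

lemma re_expsum_line_deriv:
  "((\<lambda>t. re_expsum m L (\<lambda>a. x a + t * y a)) has_real_derivative
     (\<Sum>a<m. y a * re_expsum m (dcoeff a L) (\<lambda>a. x a + t * y a))) (at t)"
proof (induct L)
  case Nil
  then show ?case by (simp add: dcoeff_def)
next
  case (Cons cw L)
  obtain c w where cw: "cw = (c, w)" by (cases cw)
  define h where "h t = (\<Sum>a<m. w a * (x a + t * y a))" for t
  have h: "(h has_real_derivative (\<Sum>a<m. w a * y a)) (at t)"
    unfolding h_def by (auto intro!: derivative_eq_intros sum.cong)
  have "((\<lambda>t. Re c * cos (h t) - Im c * sin (h t)) has_real_derivative
      (\<Sum>a<m. w a * y a) * (- Re c * sin (h t) - Im c * cos (h t))) (at t)"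
    by (auto intro!: derivative_eq_intros h simp: algebra_simps)
  from DERIV_add[OF this Cons]
  have "((\<lambda>t. Re c * cos (h t) - Im c * sin (h t) + re_expsum m L (\<lambda>a. x a + t * y a)) has_real_derivative
      (\<Sum>a<m. w a * y a) * (- Re c * sin (h t) - Im c * cos (h t)) +
      (\<Sum>a<m. y a * re_expsum m (dcoeff a L) (\<lambda>a. x a + t * y a))) (at t)" .
  moreover have "(\<Sum>a<m. y a * re_expsum m (dcoeff a (cw # L)) (\<lambda>a. x a + t * y a)) =
      (\<Sum>a<m. w a * y a) * (- Re c * sin (h t) - Im c * cos (h t)) +
      (\<Sum>a<m. y a * re_expsum m (dcoeff a L) (\<lambda>a. x a + t * y a))"
  proof -
    define K where "K = - Re c * sin (h t) - Im c * cos (h t)"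
    have "re_expsum m (dcoeff a (cw # L)) (\<lambda>a. x a + t * y a) =
        w a * K + re_expsum m (dcoeff a L) (\<lambda>a. x a + t * y a)" for a
      by (simp add: cw dcoeff_def expsum_Cons h_def[symmetric] K_def, simp add: algebra_simps)
    then show ?thesis
      unfolding K_def[symmetric] by (simp add: distrib_left sum.distrib sum_distrib_left mult_ac)
  qed
  moreover have "re_expsum m (cw # L) (\<lambda>a. x a + t * y a) =
      Re c * cos (h t) - Im c * sin (h t) + re_expsum m L (\<lambda>a. x a + t * y a)" for t
    by (simp add: cw expsum_Cons h_def)
  ultimately show ?case by simp
qed

lemma partial_re_expsum:
  assumes F: "\<And>ys. length ys = m \<Longrightarrow> F ys = re_expsum m L ((!) ys)"
    and xs: "length xs = m" and b: "b < m"
  shows "partial F b xs = re_expsum m (dcoeff b L) ((!) xs)"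
proof -
  \<comment> \<open>With coordinate \<open>b\<close> of the base point set to 0, the line parameter
    is coordinate \<open>b\<close> itself, as in \<open>partial\<close>; \<open>xs\<close> is
    reached at parameter \<open>xs ! b\<close>.\<close>
  define x where "x a = (if a = b then 0 else xs ! a)" for a
  define y where "y a = (if a = b then 1 else (0::real))" for a
  have line: "F (xs[b := t]) = re_expsum m L (\<lambda>a. x a + t * y a)" for t
  proof -
    have "F (xs[b := t]) = re_expsum m L ((!) (xs[b := t]))" using xs by (simp add: F)
    also have "expsum m L ((!) (xs[b := t])) = expsum m L (\<lambda>a. x a + t * y a)"
      by (rule expsum_cong) (use xs in \<open>auto simp: x_def y_def nth_list_update\<close>)
    finally show ?thesis .
  qed
  have pt: "expsum m L' (\<lambda>a. x a + xs ! b * y a) = expsum m L' ((!) xs)" for L'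
    by (rule expsum_cong) (auto simp: x_def y_def)
  have "((\<lambda>t. F (xs[b := t])) has_real_derivative re_expsum m (dcoeff b L) ((!) xs)) (at (xs ! b))"
    unfolding line
    using re_expsum_line_deriv[of m L x y "xs ! b"] b
    by (simp add: pt) (simp add: y_def if_distrib[of "\<lambda>x. x * _"] cong: if_cong)
  then show ?thesis
    unfolding partial_def by (intro the_equality) (auto dest: DERIV_unique)
qed

section \<open>Second-order conditions and the Hessian\<close>

text \<open>A negative \<open>D\<close> would make \<open>h'\<close> negative just to the right of
  its zero at 0, and the mean value theorem would give a value below \<open>h 0\<close>.\<close>

lemma second_order_necessary:
  fixes h :: "real \<Rightarrow> real"
  assumes d1: "\<And>t. (h has_real_derivative h' t) (at t)"
    and d2: "(h' has_real_derivative D) (at 0)"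
    and e: "0 < e" and min: "\<And>t. \<bar>t\<bar> < e \<Longrightarrow> h 0 \<le> h t"
  shows "h' 0 = 0" and "0 \<le> D"
proof -
  show h0: "h' 0 = 0"
    by (rule DERIV_local_min[OF d1 e]) (use min in auto)
  show "0 \<le> D"
  proof (rule ccontr)
    assume "\<not> 0 \<le> D"
    then obtain d where d: "d > 0" "\<And>t. 0 < t \<Longrightarrow> t < d \<Longrightarrow> h' t < h' 0"
      using DERIV_neg_dec_right[OF d2] by auto
    define s where "s = min d e / 2"
    have s: "0 < s" "s < d" "s < e" using d e by (auto simp: s_def)
    obtain z where z: "0 < z" "z < s" "h s - h 0 = (s - 0) * h' z"
      using MVT2[OF s(1), of h h'] d1 by blast
    have "h' z < 0" using d(2)[of z] z s h0 by simp
    then have "h s < h 0" using z s by (metis diff_0_right diff_less_0_iff_less mult_pos_neg)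
    with min[of s] s show False by auto
  qed
qed

text \<open>On the basis \<open>v\<close>, \<open>w\<close> and the unit vectors other than \<open>b\<close>, \<open>g\<close>, the Hessian is the direct
  sum of a hyperbolic plane and a positive semidefinite block: invariance along \<open>v\<close> on the
  hyperplane \<open>u g = 0\<close> forces \<open>H v\<close> to be a multiple of the unit vector \<open>g\<close>, and symmetrically for
  \<open>w\<close>.\<close>

lemma transition_state_or_singular:
  fixes F :: "real list \<Rightarrow> real" and v w :: "nat \<Rightarrow> real"
  assumes F: "\<And>ys. length ys = m \<Longrightarrow> F ys = re_expsum m L ((!) ys)"
    and xs: "length xs = m" and bg: "b < m" "g < m" "b \<noteq> g" and x0: "xs ! b = 0" "xs ! g = 0"
    and v: "v b = 1" "v g = 0" and w: "w g = 1" "w b = 0"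
    and inv_v: "\<And>u t. u g = 0 \<Longrightarrow> re_expsum m L (\<lambda>a. u a + t * v a) = re_expsum m L u"
    and inv_w: "\<And>u t. u b = 0 \<Longrightarrow> re_expsum m L (\<lambda>a. u a + t * w a) = re_expsum m L u"
    and min: "\<And>y. y b = 0 \<Longrightarrow> y g = 0 \<Longrightarrow>
       \<exists>e>0. \<forall>t. \<bar>t\<bar> < e \<longrightarrow> re_expsum m L ((!) xs) \<le> re_expsum m L (\<lambda>a. xs ! a + t * y a)"
  shows "transition_state F m xs \<or> det (hessian F m xs) = 0"
proof (cases "det (hessian F m xs) = 0")
  case False
  define x where "x = (!) xs"
  define G where "G a = re_expsum m (dcoeff a L) x" for a
  define H where "H a b = re_expsum m (dcoeff a (dcoeff b L)) x" for a b
  have part: "partial F a ys = re_expsum m (dcoeff a L) ((!) ys)" if "a < m" "length ys = m" for a ys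
    using partial_re_expsum[OF F] that by simp
  have hess: "hessian F m xs $$ (a, c) = H a c" if "a < m" "c < m" for a c
    using that partial_re_expsum[OF part[OF that(2)] xs that(1)]
    by (simp add: hessian_def H_def x_def)
  have hc: "hessian F m xs \<in> carrier_mat m m" by (simp add: hessian_def)
  have sym: "H a c = H c a" for a c by (simp add: H_def dcoeff_commute)
  define E where "E k a = (if a = k then 1 else (0::real))" for k a :: nat
  have E: "(\<Sum>a<m. E k a * f a) = f k" if "k < m" for k f
    using that by (simp add: E_def if_distrib[of "\<lambda>x. x * _"] cong: if_cong)
  have deriv0: "((\<lambda>t. re_expsum m L' (\<lambda>a. x a + t * y a)) has_real_derivative
     (\<Sum>a<m. y a * re_expsum m (dcoeff a L') x)) (at 0)" for L' y
    using re_expsum_line_deriv[of m L' x y 0] by simp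

  have inv_grad: "(\<Sum>a<m. z a * re_expsum m (dcoeff a L) u) = 0"
    if "\<And>t. re_expsum m L (\<lambda>a. u a + t * z a) = re_expsum m L u" for z u
  proof -
    have "((\<lambda>t. re_expsum m L (\<lambda>a. u a + t * z a)) has_real_derivative
       (\<Sum>a<m. z a * re_expsum m (dcoeff a L) u)) (at 0)"
      using re_expsum_line_deriv[of m L u z 0] by simp
    then show ?thesis unfolding that by (metis DERIV_const DERIV_unique)
  qed
  have inv_hess: "(\<Sum>a<m. H c a * z a) = 0"
    if c: "c < m" "c \<noteq> k" and xk: "x k = 0"
      and inv: "\<And>u t. u k = 0 \<Longrightarrow> re_expsum m L (\<lambda>a. u a + t * z a) = re_expsum m L u" for z c k
  proof -
    \<comment> \<open>Moving the base point in a coordinate \<open>c\<close> other than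
      \<open>k\<close> keeps coordinate \<open>k\<close> at 0, so the derivative along
      \<open>z\<close> vanishes on this whole line; differentiating once more gives entry
      \<open>c\<close> of \<open>H z\<close>.\<close>
    have zero: "(\<lambda>t. \<Sum>a<m. z a * re_expsum m (dcoeff a L) (\<lambda>a. x a + t * E c a)) = (\<lambda>t. 0)"
      by (rule ext, rule inv_grad, rule inv) (use c xk in \<open>auto simp: E_def\<close>)
    have "((\<lambda>t. \<Sum>a<m. z a * re_expsum m (dcoeff a L) (\<lambda>a. x a + t * E c a)) has_real_derivative
       (\<Sum>a<m. z a * (\<Sum>d<m. E c d * re_expsum m (dcoeff d (dcoeff a L)) x))) (at 0)"
      by (intro DERIV_sum DERIV_cmult deriv0)
    from DERIV_unique[OF this[unfolded zero] DERIV_const]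
    have "(\<Sum>a<m. z a * (\<Sum>d<m. E c d * re_expsum m (dcoeff d (dcoeff a L)) x)) = 0" .
    then show ?thesis using c by (simp add: E H_def mult.commute)
  qed

  have second: "(\<Sum>a<m. y a * G a) = 0 \<and> 0 \<le> qform m H y" if y: "y b = 0" "y g = 0" for y
  proof -
    obtain e where e: "e > 0" "\<And>t. \<bar>t\<bar> < e \<Longrightarrow> re_expsum m L x \<le> re_expsum m L (\<lambda>a. x a + t * y a)"
      using min[OF y] by (auto simp: x_def)
    define h where "h t = re_expsum m L (\<lambda>a. x a + t * y a)" for t
    define h' where "h' t = (\<Sum>a<m. y a * re_expsum m (dcoeff a L) (\<lambda>a. x a + t * y a))" for t
    have 1: "(h has_real_derivative h' t) (at t)" for t
      unfolding h_def h'_def by (rule re_expsum_line_deriv)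
    have 2: "(h' has_real_derivative (\<Sum>a<m. y a * (\<Sum>d<m. y d * re_expsum m (dcoeff d (dcoeff a L)) x))) (at 0)"
      unfolding h'_def by (intro DERIV_sum DERIV_cmult deriv0)
    have 3: "h 0 \<le> h t" if "\<bar>t\<bar> < e" for t using e(2)[OF that] by (simp add: h_def)
    from second_order_necessary[OF 1 2 e(1) 3]
    have "h' 0 = 0" "0 \<le> (\<Sum>a<m. y a * (\<Sum>d<m. y d * re_expsum m (dcoeff d (dcoeff a L)) x))" by auto
    moreover have "(\<Sum>a<m. y a * (\<Sum>d<m. y d * re_expsum m (dcoeff d (dcoeff a L)) x)) = qform m H y"
      unfolding qform_def sum_distrib_left
      by (intro sum.cong refl) (simp add: H_def dcoeff_commute mult_ac)
    ultimately show ?thesis by (simp add: h'_def G_def)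
  qed

  have G0: "G a = 0" if "a < m" "a \<noteq> b" "a \<noteq> g" for a
    using second[of "E a"] that E[of a G] by (auto simp: E_def)
  have Gb: "G b = 0"
  proof -
    \<comment> \<open>Only the term at \<open>b\<close> survives: \<open>v g = 0\<close>, and the
      remaining partial derivatives vanish by minimality.\<close>
    have "0 = (\<Sum>a<m. v a * G a)"
      unfolding G_def by (rule inv_grad[symmetric], rule inv_v) (simp add: x_def x0)
    also have "\<dots> = (\<Sum>a<m. E b a * G b)"
      by (intro sum.cong refl) (use G0 v bg in \<open>auto simp: E_def\<close>)
    finally show ?thesis using E[of b "\<lambda>_. G b"] bg by simp
  qed
  have Gg: "G g = 0"
  proof -
    have "0 = (\<Sum>a<m. w a * G a)"
      unfolding G_def by (rule inv_grad[symmetric], rule inv_w) (simp add: x_def x0)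
    also have "\<dots> = (\<Sum>a<m. E g a * G g)"
      by (intro sum.cong refl) (use G0 w bg in \<open>auto simp: E_def\<close>)
    finally show ?thesis using E[of g "\<lambda>_. G g"] bg by simp
  qed
  have stat: "stationary F m xs"
    unfolding stationary_def using G0 Gb Gg part xs by (auto simp: G_def x_def)

  define Hm where "Hm z c = (\<Sum>a<m. H c a * z a)" for z c
  define ip where "ip y z = (\<Sum>c<m. y c * z c)" for y z :: "nat \<Rightarrow> real"
  have ip_cong: "ip y z = ip y' z'" if "\<And>a. a < m \<Longrightarrow> y a = y' a" "\<And>a. a < m \<Longrightarrow> z a = z' a" for y z y' z'
    using that by (simp add: ip_def)
  have adj: "ip y (Hm z) = ip z (Hm y)" for y z
    by (simp add: ip_def Hm_def sum_distrib_left, subst sum.swap)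
       (auto intro!: sum.cong simp: sym mult_ac)
  have qf: "qform m H z = ip z (Hm z)" for z
    by (simp add: qform_def ip_def Hm_def sum_distrib_left mult.assoc)
  define k where "k = Hm v g"
  have Hv: "Hm v c = k * E g c" if "c < m" for c
    using inv_hess[OF that, of g v] inv_v by (cases "c = g") (auto simp: k_def E_def Hm_def x_def x0)
  define k' where "k' = Hm w b"
  have Hw: "Hm w c = k' * E b c" if "c < m" for c
    using inv_hess[OF that, of b w] inv_w by (cases "c = b") (auto simp: k'_def E_def Hm_def x_def x0)
  have ipE: "ip z (\<lambda>c. s * E a c) = s * z a" if "a < m" for z s a
    using E[OF that, of "\<lambda>c. s * z c"] by (simp add: ip_def mult_ac)
  \<comment> \<open>Both constants are the pairing of \<open>v\<close> with \<open>H w\<close>,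
    evaluated from either side by symmetry.\<close>
  have kk: "k' = k"
  proof -
    have "k' = ip v (Hm w)" using ip_cong[of v v "Hm w" "\<lambda>c. k' * E b c"] Hw ipE[OF bg(1)] v by simp
    also have "\<dots> = ip w (Hm v)" by (rule adj)
    also have "\<dots> = k" using ip_cong[of w w "Hm v" "\<lambda>c. k * E g c"] Hv ipE[OF bg(2)] w by simp
    finally show ?thesis .
  qed
  have k0: "k \<noteq> 0"
  proof
    \<comment> \<open>Then \<open>H v = 0\<close> although \<open>v b = 1\<close>, so the Hessian is
      singular.\<close>
    assume k: "k = 0"
    define vv where "vv = vec m v"
    have "vv \<in> carrier_vec m" "vv \<noteq> 0\<^sub>v m"
      using v(1) bg(1) by (auto simp: vv_def dest!: arg_cong[of _ _ "\<lambda>v. v $ b"])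
    moreover have "hessian F m xs *\<^sub>v vv = 0\<^sub>v m"
    proof (rule eq_vecI)
      fix c assume "c < dim_vec (0\<^sub>v m)"
      then have c: "c < m" by simp
      then have "(hessian F m xs *\<^sub>v vv) $ c = Hm v c"
        using hc by (auto simp: scalar_prod_def vv_def Hm_def atLeast0LessThan hess intro!: sum.cong)
      then show "(hessian F m xs *\<^sub>v vv) $ c = 0\<^sub>v m $ c" using Hv c k by simp
    qed (use hc in auto)
    ultimately have "det (hessian F m xs) = 0" using det_0_iff_vec_prod_zero[OF hc] by blast
    with False show False by simp
  qed
  \<comment> \<open>Subtracting the parts along \<open>v\<close> and \<open>w\<close> leaves a
    vector vanishing at \<open>b\<close> and \<open>g\<close>. It has no cross terms with
    \<open>v\<close> and \<open>w\<close>, since \<open>H v\<close> and \<open>H w\<close> are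
    supported at \<open>g\<close> and \<open>b\<close>.\<close>
  have decomp: "qform m H z = qform m H (\<lambda>a. z a - z b * v a - z g * w a) + 2 * k * z b * z g" for z
  proof -
    define y where "y a = z a - z b * v a - z g * w a" for a
    have y: "y b = 0" "y g = 0" using v w by (auto simp: y_def)
    have Hz: "Hm z c = Hm y c + (z b * k * E g c + z g * k * E b c)" if "c < m" for c
    proof -
      have "Hm y c = Hm z c - z b * Hm v c - z g * Hm w c"
        by (simp add: Hm_def y_def sum_distrib_left sum_subtractf algebra_simps)
      then show ?thesis using that by (simp add: Hv Hw kk)
    qed
    have split: "ip u (Hm z) = ip u (Hm y) + z b * k * u g + z g * k * u b" for u
    proof -
      have "ip u (Hm z) = ip u (Hm y) + ip u (\<lambda>c. z b * k * E g c) + ip u (\<lambda>c. z g * k * E b c)"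
        by (simp add: ip_def Hz distrib_left sum.distrib)
      then show ?thesis using ipE bg by simp
    qed
    have "qform m H z = ip z (Hm y) + 2 * k * z b * z g"
      using split[of z] by (simp add: qf)
    also have "ip z (Hm y) = ip y (Hm z)" by (rule adj)
    also have "ip y (Hm z) = qform m H y" using split[of y] y by (simp add: qf)
    finally show ?thesis by (simp add: y_def[abs_def])
  qed
  define f where "f a = (if a = g then 1 else if a = b then - sgn k else 0)" for a
  have f: "(\<Sum>a<m. f a * z a) = z g - sgn k * z b" for z
  proof -
    have "(\<Sum>a<m. f a * z a) = (\<Sum>a<m. E g a * z a - sgn k * (E b a * z a))"
      by (intro sum.cong refl) (use bg in \<open>auto simp: f_def E_def\<close>)
    then show ?thesis using bg by (simp add: sum_subtractf E flip: sum_distrib_left)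
  qed
  have nn: "0 \<le> qform m H z" if "(\<Sum>a<m. f a * z a) = 0" for z
  proof -
    have zg: "z g = sgn k * z b" using that by (simp add: f)
    have "2 * k * z b * z g = 2 * \<bar>k\<bar> * (z b)^2"
      by (simp add: zg abs_sgn[of k] power2_eq_square mult_ac)
    then show ?thesis
      using decomp[of z] second[of "\<lambda>a. z a - z b * v a - z g * w a"] v w by simp
  qed
  \<comment> \<open>Here the remainder in \<open>decomp\<close> is zero and the entries at
    \<open>b\<close> and \<open>g\<close> are 1 and \<open>- sgn k\<close>, so the hyperbolic term
    is -2 |k|.\<close>
  have neg: "qform m H (\<lambda>a. v a - sgn k * w a) < 0"
  proof -
    have "qform m H (\<lambda>a. v a - sgn k * w a) = 2 * k * (- sgn k)"
      by (subst decomp) (simp add: v w qform_def)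
    also have "\<dots> = - 2 * \<bar>k\<bar>" by (simp add: abs_sgn[of k] mult_ac)
    finally show ?thesis using k0 by simp
  qed
  have qh: "qform m (\<lambda>a c. hessian F m xs $$ (a, c)) z = qform m H z" for z
    by (simp add: qform_def hess)
  show ?thesis
    unfolding transition_state_def
    using stat one_negative_eigenvalue[OF hc _ False, of f "\<lambda>a. v a - sgn k * w a"] nn neg
    by (simp add: qh hess sym)
qed simp

section \<open>The circuit in the Walsh basis\<close>

text \<open>The eigenvalue of \<open>sigma_z n i\<close> on the basis state
  \<open>r\<close>.\<close>

definition spin :: "nat \<Rightarrow> nat \<Rightarrow> real" where
  "spin r i = (if bit r i then - 1 else 1)"

text \<open>The character (-1)^(r.s) of bit strings: an entry of the unnormalised Hadamard matrix,
  which diagonalises all \<open>sigma_x\<close> at once.\<close>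

definition walsh :: "nat \<Rightarrow> nat \<Rightarrow> nat \<Rightarrow> real" where
  "walsh n r s = (\<Prod>i<n. if bit r i \<and> bit s i then - 1 else 1)"

lemma walsh_commute: "walsh n r s = walsh n s r"
  by (simp add: walsh_def conj_commute)

lemma walsh_zero [simp]: "walsh n 0 s = 1" "walsh n r 0 = 1"
  by (simp_all add: walsh_def)

lemma walsh_square: "walsh n r s * walsh n r s = 1"
  by (simp add: walsh_def flip: prod.distrib)

lemma flip_bit_less:
  fixes r :: nat
  assumes "r < 2 ^ n" "i < n"
  shows "flip_bit i r < 2 ^ n"
proof -
  have "take_bit n (flip_bit i r) = flip_bit i r"
    using assms by (simp add: take_bit_flip_bit_eq take_bit_nat_eq_self)
  then show ?thesis by (metis take_bit_nat_less_exp)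
qed

lemma flip_bit_flip_bit [simp]: "flip_bit i (flip_bit i r) = (r :: nat)"
  by (rule bit_eqI) (auto simp: bit_flip_bit_iff)

lemma nat_eq_if_bits_eq:
  fixes r s :: nat
  assumes "r < 2 ^ n" "s < 2 ^ n" "\<And>i. i < n \<Longrightarrow> bit r i = bit s i"
  shows "r = s"
proof -
  have "take_bit n r = take_bit n s"
    by (rule bit_eqI) (use assms(3) in \<open>auto simp: bit_take_bit_iff\<close>)
  with assms(1,2) show ?thesis by (simp add: take_bit_nat_eq_self)
qed

text \<open>Flipping bit \<open>i\<close> of \<open>r\<close> affects only factor \<open>i\<close>.
  So a Walsh function is an eigenvector of every \<open>sigma_x n i\<close>.\<close>

lemma walsh_flip_bit:
  assumes "i < n"
  shows "walsh n (flip_bit i r) s = spin s i * walsh n r s"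
proof -
  have 1: "(\<Prod>k\<in>{..<n} - {i}. if bit (flip_bit i r) k \<and> bit s k then - 1 else 1) =
      (\<Prod>k\<in>{..<n} - {i}. if bit r k \<and> bit s k then - 1 else (1::real))"
    by (intro prod.cong) (auto simp: bit_flip_bit_iff)
  have 2: "bit (flip_bit i r) i \<longleftrightarrow> \<not> bit r i" by (simp add: bit_flip_bit_iff)
  show ?thesis
    unfolding walsh_def
    by (subst (1 2) prod.remove[of _ i]) (use assms in \<open>auto simp: 1 2 spin_def\<close>)
qed

text \<open>If \<open>r\<close> and \<open>s\<close> differ in bit \<open>i\<close>, flipping that
  bit of the summation index negates every term, so the sum equals its own negative.\<close>

lemma walsh_orthogonal:
  assumes "r < 2 ^ n" "s < 2 ^ n"
  shows "(\<Sum>k<2 ^ n. walsh n r k * walsh n k s) = (if r = s then 2 ^ n else 0)"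
proof (cases "r = s")
  case True
  then show ?thesis by (simp add: walsh_commute[of n _ s] walsh_square)
next
  case False
  then obtain i where i: "i < n" "bit r i \<noteq> bit s i"
    using nat_eq_if_bits_eq[OF assms] by blast
  have "(\<Sum>k<2 ^ n. walsh n r k * walsh n k s) =
      (\<Sum>k<2 ^ n. walsh n r (flip_bit i k) * walsh n (flip_bit i k) s)"
    by (rule sum.reindex_bij_witness[of _ "flip_bit i" "flip_bit i"])
       (use i flip_bit_less in auto)
  also have "\<dots> = (\<Sum>k<2 ^ n. - (walsh n r k * walsh n k s))"
  proof (rule sum.cong[OF refl])
    fix k
    have "walsh n r (flip_bit i k) = spin r i * walsh n r k"
      using i(1) by (metis walsh_commute walsh_flip_bit)
    moreover have "walsh n (flip_bit i k) s = spin s i * walsh n k s"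
      using i(1) by (rule walsh_flip_bit)
    moreover have "spin r i * spin s i = - 1" using i(2) by (auto simp: spin_def)
    ultimately show "walsh n r (flip_bit i k) * walsh n (flip_bit i k) s = - (walsh n r k * walsh n k s)"
      by (metis (no_types, lifting) mult.assoc mult.commute mult_minus1)
  qed
  finally show ?thesis using False by (simp add: sum_negf)
qed

section \<open>Exponentials of the two Hamiltonians\<close>

text \<open>\<open>P\<close> and \<open>Q\<close> are mutually inverse, so they diagonalise every
  power, and the exponential series can be summed on the diagonal.\<close>

lemma exp_mat_diagonalized:
  fixes A :: "complex mat" and P Q :: "nat \<Rightarrow> nat \<Rightarrow> complex" and d :: "nat \<Rightarrow> complex"
  assumes A: "A \<in> carrier_mat N N"
    and Ad: "\<And>r c. r < N \<Longrightarrow> c < N \<Longrightarrow> A $$ (r, c) = (\<Sum>s<N. P r s * d s * Q s c)"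
    and PQ: "\<And>r c. r < N \<Longrightarrow> c < N \<Longrightarrow> (\<Sum>s<N. P r s * Q s c) = (if r = c then 1 else 0)"
    and QP: "\<And>r c. r < N \<Longrightarrow> c < N \<Longrightarrow> (\<Sum>s<N. Q r s * P s c) = (if r = c then 1 else 0)"
    and rc: "r < N" "c < N"
  shows "exp_mat (z \<cdot>\<^sub>m A) $$ (r, c) = (\<Sum>s<N. P r s * exp (z * d s) * Q s c)"
proof -
  have pow: "(z \<cdot>\<^sub>m A) ^\<^sub>m k \<in> carrier_mat N N \<and>
     (\<forall>r<N. \<forall>c<N. ((z \<cdot>\<^sub>m A) ^\<^sub>m k) $$ (r, c) = (\<Sum>s<N. P r s * (z * d s) ^ k * Q s c))" for k
  proof (induct k)
    case 0
    show ?case using A PQ by simp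
  next
    case (Suc k)
    define X where "X = (z \<cdot>\<^sub>m A) ^\<^sub>m k"
    have X: "X \<in> carrier_mat N N"
      "\<And>r c. r < N \<Longrightarrow> c < N \<Longrightarrow> X $$ (r, c) = (\<Sum>s<N. P r s * (z * d s) ^ k * Q s c)"
      using Suc by (auto simp: X_def)
    have "(X * (z \<cdot>\<^sub>m A)) $$ (r, c) = (\<Sum>s<N. P r s * (z * d s) ^ Suc k * Q s c)"
      if rc: "r < N" "c < N" for r c
    proof -
      have "(X * (z \<cdot>\<^sub>m A)) $$ (r, c) = (\<Sum>e<N. X $$ (r, e) * (z * A $$ (e, c)))"
        using rc X(1) A by (auto simp: scalar_prod_def atLeast0LessThan intro!: sum.cong)
      also have "\<dots> = (\<Sum>e<N. \<Sum>s<N. \<Sum>t<N. (P r s * (z * d s) ^ k) * (Q s e * P e t) * (z * d t * Q t c))"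
        using rc by (intro sum.cong refl) (simp add: X(2) Ad sum_distrib_left sum_distrib_right mult_ac)
      also have "\<dots> = (\<Sum>s<N. \<Sum>t<N. \<Sum>e<N. (P r s * (z * d s) ^ k) * (Q s e * P e t) * (z * d t * Q t c))"
        by (subst sum.swap, rule sum.cong[OF refl], rule sum.swap)
      \<comment> \<open>The inner sum over \<open>e\<close> is an entry of the identity
        \<open>Q P\<close>.\<close>
      also have "\<dots> = (\<Sum>s<N. \<Sum>t<N. (P r s * (z * d s) ^ k) * (if s = t then 1 else 0) * (z * d t * Q t c))"
        by (intro sum.cong refl) (simp add: QP[symmetric] sum_distrib_left sum_distrib_right)
      also have "\<dots> = (\<Sum>s<N. P r s * (z * d s) ^ Suc k * Q s c)"
        by (intro sum.cong refl)
           (simp add: if_distrib[of "\<lambda>x. _ * x"] if_distrib[of "\<lambda>x. x * _"] mult_ac cong: if_cong)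
      finally show ?thesis .
    qed
    moreover have "X * (z \<cdot>\<^sub>m A) \<in> carrier_mat N N" using X(1) A by auto
    ultimately show ?case by (simp add: X_def)
  qed
  have "(\<lambda>k. \<Sum>s<N. P r s * (z * d s) ^ k * Q s c / fact k) sums (\<Sum>s<N. P r s * exp (z * d s) * Q s c)"
  proof (intro sums_sum)
    fix s
    have "(\<lambda>k. (z * d s) ^ k /\<^sub>R fact k) sums exp (z * d s)" by (rule exp_converges)
    from sums_mult2[OF sums_mult[OF this], of "P r s" "Q s c"]
    show "(\<lambda>k. P r s * (z * d s) ^ k * Q s c / fact k) sums (P r s * exp (z * d s) * Q s c)"
      by (simp add: scaleR_conv_of_real field_simps)
  qed
  moreover have "exp_mat (z \<cdot>\<^sub>m A) $$ (r, c) = (\<Sum>k. \<Sum>s<N. P r s * (z * d s) ^ k * Q s c / fact k)"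
    using rc A pow by (simp add: exp_mat_def sum_divide_distrib)
  ultimately show ?thesis by (simp add: sums_iff)
qed

definition cost :: "(nat \<times> nat) set \<Rightarrow> nat \<Rightarrow> real" where
  "cost E r = (\<Sum>(i, j)\<in>E. spin r i * spin r j)"

definition mixer_eigenvalue :: "nat \<Rightarrow> nat \<Rightarrow> real" where
  "mixer_eigenvalue n s = - (\<Sum>i<n. spin s i)"

text \<open>The entry of exp(-i t \<open>H_B\<close>) in diagonalised form; the Walsh matrix divided
  by \<open>2 ^ n\<close> is its own inverse transform.\<close>

definition mixer_entry :: "nat \<Rightarrow> real \<Rightarrow> nat \<Rightarrow> nat \<Rightarrow> complex" where
  "mixer_entry n t r c = (\<Sum>s<2 ^ n. of_real (walsh n r s / 2 ^ n) * cis (- t * mixer_eigenvalue n s) * of_real (walsh n s c))"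

lemma H_C_index:
  assumes "r < 2 ^ n" "c < 2 ^ n"
  shows "H_C n E $$ (r, c) = (if r = c then of_real (cost E r) else 0)"
proof -
  have "(sigma_z n i * sigma_z n j) $$ (r, c) = (if r = c then of_real (spin r i * spin r j) else 0)" for i j
  proof -
    have "(sigma_z n i * sigma_z n j) $$ (r, c) =
        (\<Sum>k<2 ^ n. sigma_z n i $$ (r, k) * sigma_z n j $$ (k, c))"
      using assms by (auto simp: sigma_z_def dimq_def scalar_prod_def atLeast0LessThan intro!: sum.cong)
    also have "\<dots> = (\<Sum>k<2 ^ n. if k = r then (if r = c then of_real (spin r i * spin r j) else 0) else 0)"
      using assms by (intro sum.cong refl) (auto simp: sigma_z_def dimq_def spin_def)
    finally show ?thesis using assms by simp
  qed
  then show ?thesis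
    using assms by (simp add: H_C_def dimq_def cost_def case_prod_beta)
qed

text \<open>\<open>H_C\<close> is already diagonal, so both transforms in
  \<open>exp_mat_diagonalized\<close> are the identity.\<close>

lemma exp_H_C:
  assumes "r < 2 ^ n" "c < 2 ^ n"
  shows "exp_mat ((- \<i> * of_real t) \<cdot>\<^sub>m H_C n E) $$ (r, c) = (if r = c then cis (- t * cost E r) else 0)"
proof -
  have *: "(\<Sum>s<2 ^ n. (if r = s then 1 else 0) * f s * (if s = c then 1 else (0::complex))) =
      (if r = c then f r else 0)" if "r < 2 ^ n" for f and r c :: nat
    using that by (simp add: if_distrib[of "\<lambda>x. x * _"] if_distrib[of "\<lambda>x. _ * x"] cong: if_cong)
  have **: "(\<Sum>s<2 ^ n. (if r = s then 1 else 0) * (if s = c then 1 else (0::complex))) =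
      (if r = c then 1 else 0)" if "r < 2 ^ n" for r c :: nat
    using *[OF that, of "\<lambda>_. 1" c] by simp
  have "exp_mat ((- \<i> * of_real t) \<cdot>\<^sub>m H_C n E) $$ (r, c) =
    (\<Sum>s<2 ^ n. (if r = s then 1 else 0) * exp ((- \<i> * of_real t) * of_real (cost E s)) * (if s = c then 1 else 0))"
    by (rule exp_mat_diagonalized)
       (use assms in \<open>auto simp: * ** H_C_index\<close>, auto simp: H_C_def dimq_def)
  also have "\<dots> = (if r = c then exp ((- \<i> * of_real t) * of_real (cost E r)) else 0)"
    using assms(1) by (rule *)
  finally show ?thesis by (simp add: cis_conv_exp mult.assoc)
qed

text \<open>A factor \<open>spin s i\<close> moves \<open>walsh n r s\<close> to
  \<open>flip_bit i r\<close>; orthogonality then picks out the entries of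
  \<open>sigma_x\<close>.\<close>

lemma H_B_index:
  assumes "r < 2 ^ n" "c < 2 ^ n"
  shows "H_B n $$ (r, c) =
    (\<Sum>s<2 ^ n. of_real (walsh n r s / 2 ^ n) * of_real (mixer_eigenvalue n s) * of_real (walsh n s c))"
proof -
  have "(\<Sum>s<2 ^ n. walsh n r s / 2 ^ n * mixer_eigenvalue n s * walsh n s c) =
      (\<Sum>s<2 ^ n. \<Sum>i<n. - (walsh n (flip_bit i r) s * walsh n s c / 2 ^ n))"
    by (intro sum.cong refl)
       (simp add: mixer_eigenvalue_def walsh_flip_bit sum_negf sum_distrib_left sum_distrib_right sum_divide_distrib mult_ac)
  also have "\<dots> = (\<Sum>i<n. - ((\<Sum>s<2 ^ n. walsh n (flip_bit i r) s * walsh n s c) / 2 ^ n))"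
    by (subst sum.swap) (simp add: sum_negf sum_divide_distrib)
  also have "\<dots> = (\<Sum>i<n. - (if c = flip_bit i r then 1 else 0))"
    using assms by (intro sum.cong refl) (simp add: walsh_orthogonal flip_bit_less)
  also have "\<dots> = - (\<Sum>i<n. if c = flip_bit i r then 1 else 0)"
    by (rule sum_negf)
  finally have "of_real (\<Sum>s<2 ^ n. walsh n r s / 2 ^ n * mixer_eigenvalue n s * walsh n s c) =
      (of_real (- (\<Sum>i<n. if c = flip_bit i r then 1 else 0)) :: complex)" by simp
  moreover have "H_B n $$ (r, c) = of_real (- (\<Sum>i<n. if c = flip_bit i r then 1 else 0))"
    using assms by (simp add: H_B_def sigma_x_def dimq_def if_distrib[of of_real] cong: if_cong)
  ultimately show ?thesis by simp
qed

lemma exp_H_B: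
  assumes "r < 2 ^ n" "c < 2 ^ n"
  shows "exp_mat ((- \<i> * of_real t) \<cdot>\<^sub>m H_B n) $$ (r, c) = mixer_entry n t r c"
proof -
  have 1: "(\<Sum>s<2 ^ n. of_real (walsh n r s / 2 ^ n) * of_real (walsh n s c)) = (if r = c then 1 else (0::complex))"
    if "r < 2 ^ n" "c < 2 ^ n" for r c
  proof -
    have "(\<Sum>s<2 ^ n. walsh n r s / 2 ^ n * walsh n s c) = (if r = c then 1 else 0)"
      using that by (simp add: walsh_orthogonal flip: sum_divide_distrib)
    then show ?thesis by (metis (no_types, lifting) of_real_0 of_real_1 of_real_mult of_real_sum sum.cong)
  qed
  have 2: "(\<Sum>s<2 ^ n. of_real (walsh n r s) * of_real (walsh n s c / 2 ^ n)) = (if r = c then 1 else (0::complex))"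
    if "r < 2 ^ n" "c < 2 ^ n" for r c
    using 1[OF that] by simp
  have "exp_mat ((- \<i> * of_real t) \<cdot>\<^sub>m H_B n) $$ (r, c) =
    (\<Sum>s<2 ^ n. of_real (walsh n r s / 2 ^ n) * exp ((- \<i> * of_real t) * of_real (mixer_eigenvalue n s)) * of_real (walsh n s c))"
  proof (rule exp_mat_diagonalized)
    show "H_B n \<in> carrier_mat (2 ^ n) (2 ^ n)" by (simp add: H_B_def dimq_def)
  qed (use assms in \<open>auto simp only: H_B_index 1 2\<close>)
  then show ?thesis by (simp add: mixer_entry_def cis_conv_exp mult.assoc)
qed

section \<open>The circuit acting on amplitude functions\<close>

text \<open>Amplitudes are functions on all naturals, but only those below \<open>2 ^ n\<close> are
  read; functions agreeing there have equal images.\<close>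

definition mix :: "nat \<Rightarrow> real \<Rightarrow> (nat \<Rightarrow> complex) \<Rightarrow> nat \<Rightarrow> complex" where
  "mix n t f r = (\<Sum>c<2 ^ n. mixer_entry n t r c * f c)"

definition phase :: "(nat \<times> nat) set \<Rightarrow> real \<Rightarrow> (nat \<Rightarrow> complex) \<Rightarrow> nat \<Rightarrow> complex" where
  "phase E t f r = cis (- t * cost E r) * f r"

fun layers :: "nat \<Rightarrow> (nat \<times> nat) set \<Rightarrow> (nat \<Rightarrow> real) \<Rightarrow> (nat \<Rightarrow> real) \<Rightarrow> nat \<Rightarrow> nat \<Rightarrow> complex" where
  "layers n E \<beta> \<gamma> 0 = (\<lambda>r. of_real (1 / sqrt (2 ^ n)))"
| "layers n E \<beta> \<gamma> (Suc k) = mix n (\<beta> k) (phase E (\<gamma> k) (layers n E \<beta> \<gamma> k))"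

definition energy :: "nat \<Rightarrow> (nat \<times> nat) set \<Rightarrow> nat \<Rightarrow> (nat \<Rightarrow> real) \<Rightarrow> (nat \<Rightarrow> real) \<Rightarrow> complex" where
  "energy n E q \<beta> \<gamma> = (\<Sum>r<2 ^ n. cnj (layers n E \<beta> \<gamma> q r) * (of_real (cost E r) * layers n E \<beta> \<gamma> q r))"

lemma qaoa_layers_index:
  "dim_vec (qaoa_layers n E q xs k) = 2 ^ n \<and>
   (\<forall>r<2 ^ n. qaoa_layers n E q xs k $ r = layers n E ((!) xs) (\<lambda>k. xs ! (q + k)) k r)"
proof (induct k)
  case 0
  show ?case by (simp add: plus_state_def dimq_def)
next
  case (Suc k)
  define \<psi> where "\<psi> = qaoa_layers n E q xs k"
  define f where "f = layers n E ((!) xs) (\<lambda>k. xs ! (q + k)) k"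
  have psi: "dim_vec \<psi> = 2 ^ n" "\<And>r. r < 2 ^ n \<Longrightarrow> \<psi> $ r = f r" using Suc by (auto simp: \<psi>_def f_def)
  define U where "U = exp_mat ((- \<i> * complex_of_real (xs ! (q + k))) \<cdot>\<^sub>m H_C n E)"
  define V where "V = exp_mat ((- \<i> * complex_of_real (xs ! k)) \<cdot>\<^sub>m H_B n)"
  have dims: "dim_row U = 2 ^ n" "dim_col U = 2 ^ n" "dim_row V = 2 ^ n" "dim_col V = 2 ^ n"
    by (simp_all add: U_def V_def exp_mat_def H_C_def H_B_def dimq_def)
  have Urc: "U $$ (r, c) = (if r = c then cis (- (xs ! (q + k)) * cost E r) else 0)"
    and Vrc: "V $$ (r, c) = mixer_entry n (xs ! k) r c" if "r < 2 ^ n" "c < 2 ^ n" for r c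
    unfolding U_def V_def using that by (rule exp_H_C exp_H_B)+
  have U: "(U *\<^sub>v \<psi>) $ r = phase E (xs ! (q + k)) f r" if r: "r < 2 ^ n" for r
  proof -
    have "(U *\<^sub>v \<psi>) $ r = (\<Sum>c<2 ^ n. U $$ (r, c) * f c)"
      using r psi dims by (auto simp: scalar_prod_def atLeast0LessThan intro!: sum.cong)
    also have "\<dots> = (\<Sum>c<2 ^ n. if c = r then cis (- (xs ! (q + k)) * cost E r) * f r else 0)"
      using r by (intro sum.cong refl) (simp add: Urc)
    finally show ?thesis using r by (simp add: phase_def)
  qed
  have "(V *\<^sub>v (U *\<^sub>v \<psi>)) $ r = mix n (xs ! k) (phase E (xs ! (q + k)) f) r" if r: "r < 2 ^ n" for r
  proof -
    have "(V *\<^sub>v (U *\<^sub>v \<psi>)) $ r = (\<Sum>c<2 ^ n. V $$ (r, c) * (U *\<^sub>v \<psi>) $ c)"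
      using r dims by (auto simp: scalar_prod_def atLeast0LessThan intro!: sum.cong)
    also have "\<dots> = mix n (xs ! k) (phase E (xs ! (q + k)) f) r"
      unfolding mix_def using r by (intro sum.cong refl) (simp add: U Vrc)
    finally show ?thesis .
  qed
  then show ?case using dims by (simp add: U_def V_def \<psi>_def f_def)
qed

lemma qaoa_energy_eq: "qaoa_energy n E q xs = Re (energy n E q ((!) xs) (\<lambda>k. xs ! (q + k)))"
proof -
  define \<psi> where "\<psi> = qaoa_layers n E q xs q"
  define f where "f = layers n E ((!) xs) (\<lambda>k. xs ! (q + k)) q"
  have psi: "dim_vec \<psi> = 2 ^ n" "\<And>r. r < 2 ^ n \<Longrightarrow> \<psi> $ r = f r"
    using qaoa_layers_index[of n E q xs q] by (auto simp: \<psi>_def f_def)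
  have "(H_C n E *\<^sub>v \<psi>) $ r = of_real (cost E r) * f r" if r: "r < 2 ^ n" for r
  proof -
    have "(H_C n E *\<^sub>v \<psi>) $ r = (\<Sum>c<2 ^ n. H_C n E $$ (r, c) * f c)"
      using r psi by (auto simp: H_C_def dimq_def scalar_prod_def atLeast0LessThan intro!: sum.cong)
    also have "\<dots> = (\<Sum>c<2 ^ n. if c = r then of_real (cost E r) * f r else 0)"
      using r by (intro sum.cong refl) (simp add: H_C_index)
    finally show ?thesis using r by simp
  qed
  then show ?thesis
    unfolding qaoa_energy_def qaoa_state_def Let_def energy_def \<psi>_def[symmetric] f_def[symmetric]
    by (simp add: psi dimq_def)
qed

text \<open>Each parameter enters only through \<open>cis\<close> of a real multiple of it, and a
  layer forms finite sums and products of such factors.\<close>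

lemma trig_poly_layers:
  "k \<le> q \<Longrightarrow> trig_poly (2 * q) (\<lambda>u. layers n E u (\<lambda>k. u (q + k)) k r)"
proof (induct k arbitrary: r)
  case 0
  show ?case by (simp add: trig_poly_const)
next
  case (Suc k)
  have c: "trig_poly (2 * q) (\<lambda>u. cis (- u l * w))" if "l < 2 * q" for l w
    using trig_poly_cis[OF that, of "- w"] by (simp add: mult.commute)
  show ?case
    unfolding layers.simps mix_def phase_def mixer_entry_def
    using Suc by (intro trig_poly_sum trig_poly_mult trig_poly_const c) auto
qed

lemma trig_poly_energy: "trig_poly (2 * q) (\<lambda>u. energy n E q u (\<lambda>k. u (q + k)))"
  unfolding energy_def
  by (intro trig_poly_sum trig_poly_mult trig_poly_const trig_poly_cnj trig_poly_layers) auto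

section \<open>Composition laws of mixers and phases\<close>

lemma mix_cong: "(\<And>r. r < 2 ^ n \<Longrightarrow> f r = g r) \<Longrightarrow> mix n t f = mix n t g"
  by (simp add: mix_def fun_eq_iff)

lemma phase_phase: "phase E t (phase E t' f) = phase E (t + t') f"
  by (simp add: phase_def fun_eq_iff cis_mult ring_distribs flip: mult.assoc)

lemma phase_0 [simp]: "phase E 0 f = f"
  by (simp add: phase_def fun_eq_iff)

text \<open>Orthogonality collapses the double Walsh sum to its diagonal, where the angles
  add.\<close>

lemma mixer_entry_mult:
  "(\<Sum>c<2 ^ n. mixer_entry n t r c * mixer_entry n t' c e) = mixer_entry n (t + t') r e"
proof -
  define a where "a s = of_real (walsh n r s / 2 ^ n) * cis (- t * mixer_eigenvalue n s)" for s
  define b where "b s = cis (- t' * mixer_eigenvalue n s) * of_real (walsh n s e)" for s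
  have "(\<Sum>c<2 ^ n. mixer_entry n t r c * mixer_entry n t' c e) =
      (\<Sum>c<2 ^ n. \<Sum>s<2 ^ n. \<Sum>s'<2 ^ n. a s * b s' * of_real (walsh n s c * walsh n c s') / 2 ^ n)"
    unfolding mixer_entry_def sum_product
    by (intro sum.cong refl) (simp add: a_def b_def mult_ac)
  also have "\<dots> = (\<Sum>s<2 ^ n. \<Sum>s'<2 ^ n. \<Sum>c<2 ^ n. a s * b s' * of_real (walsh n s c * walsh n c s') / 2 ^ n)"
    by (subst sum.swap, rule sum.cong[OF refl], rule sum.swap)
  also have "\<dots> = (\<Sum>s<2 ^ n. \<Sum>s'<2 ^ n. a s * b s' * of_real (\<Sum>c<2 ^ n. walsh n s c * walsh n c s') / 2 ^ n)"
    by (simp add: sum_distrib_left sum_divide_distrib)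
  also have "\<dots> = (\<Sum>s<2 ^ n. \<Sum>s'<2 ^ n. if s' = s then a s * b s else 0)"
    by (intro sum.cong refl) (auto simp: walsh_orthogonal)
  also have "\<dots> = (\<Sum>s<2 ^ n. a s * b s)" by simp
  also have "\<dots> = mixer_entry n (t + t') r e"
  proof -
    have "cis (- (t + t') * x) = cis (- t * x) * cis (- t' * x)" for x
      by (simp add: cis_mult ring_distribs)
    then show ?thesis
      unfolding mixer_entry_def a_def b_def by (intro sum.cong refl) (simp only: mult_ac)
  qed
  finally show ?thesis .
qed

lemma mix_mix: "mix n t (mix n t' f) = mix n (t + t') f"
proof
  fix r
  have "mix n t (mix n t' f) r = (\<Sum>c<2 ^ n. \<Sum>e<2 ^ n. mixer_entry n t r c * mixer_entry n t' c e * f e)"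
    by (simp add: mix_def sum_distrib_left mult.assoc)
  also have "\<dots> = mix n (t + t') f r"
    by (subst sum.swap) (simp add: mix_def flip: mixer_entry_mult sum_distrib_right)
  finally show "mix n t (mix n t' f) r = mix n (t + t') f r" .
qed

text \<open>Confined to indices below \<open>2 ^ n\<close>, since \<open>mix\<close> does not see
  the values of \<open>f\<close> elsewhere.\<close>

lemma mix_0:
  assumes "r < 2 ^ n"
  shows "mix n 0 f r = f r"
proof -
  have "mixer_entry n 0 r c = (if c = r then 1 else 0)" if "c < 2 ^ n" for c
  proof -
    have "mixer_entry n 0 r c = of_real ((\<Sum>s<2 ^ n. walsh n r s * walsh n s c) / 2 ^ n)"
      by (simp add: mixer_entry_def sum_divide_distrib)
    then show ?thesis using assms that by (simp add: walsh_orthogonal)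
  qed
  then have "mix n 0 f r = (\<Sum>c<2 ^ n. if c = r then f r else 0)"
    unfolding mix_def by (intro sum.cong refl) auto
  then show ?thesis using assms by simp
qed

text \<open>A constant vector is a multiple of the Walsh function of index 0, hence an eigenvector
  of the mixer.\<close>

lemma mix_uniform: "mix n t (\<lambda>_. a) r = cis (- t * mixer_eigenvalue n 0) * a"
proof -
  have w: "(\<Sum>c<2 ^ n. walsh n s c) = (if s = 0 then 2 ^ n else 0)" if "s < 2 ^ n" for s
    using walsh_orthogonal[of s n 0] that by simp
  define h where "h s = of_real (walsh n r s / 2 ^ n) * cis (- t * mixer_eigenvalue n s)" for s :: nat
  have "(\<Sum>c<2 ^ n. mixer_entry n t r c) = (\<Sum>s<2 ^ n. h s * of_real (\<Sum>c<2 ^ n. walsh n s c))"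
    unfolding mixer_entry_def h_def[symmetric] by (subst sum.swap) (simp add: sum_distrib_left)
  also have "\<dots> = (\<Sum>s<(2::nat) ^ n. if s = 0 then h 0 * 2 ^ n else 0)"
    by (intro sum.cong refl) (simp add: w)
  also have "\<dots> = cis (- t * mixer_eigenvalue n 0)" by (simp add: h_def)
  finally show ?thesis by (simp add: mix_def flip: sum_distrib_right)
qed

lemma mix_scale: "mix n t (\<lambda>r. a * f r) r = a * mix n t f r"
  by (simp add: mix_def sum_distrib_left mult_ac)

section \<open>Comparing two circuits\<close>

text \<open>A common scalar passes through later layers by linearity. Separate offsets
  \<open>k\<close> and \<open>k'\<close> allow circuits of different depth.\<close>

lemma layers_cong:
  assumes "\<And>r. r < 2 ^ n \<Longrightarrow> layers n E \<beta> \<gamma> k r = a * layers n E \<beta>' \<gamma>' k' r"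
    and "\<And>l. l < d \<Longrightarrow> \<beta> (k + l) = \<beta>' (k' + l)" "\<And>l. l < d \<Longrightarrow> \<gamma> (k + l) = \<gamma>' (k' + l)"
    and "r < 2 ^ n"
  shows "layers n E \<beta> \<gamma> (k + d) r = a * layers n E \<beta>' \<gamma>' (k' + d) r"
  using assms(2-)
proof (induct d arbitrary: r)
  case 0
  then show ?case using assms(1) by simp
next
  case (Suc d)
  have IH: "layers n E \<beta> \<gamma> (k + d) r = a * layers n E \<beta>' \<gamma>' (k' + d) r" if "r < 2 ^ n" for r
    using that by (intro Suc.hyps) (use Suc.prems in auto)
  have "mix n (\<beta> (k + d)) (phase E (\<gamma> (k + d)) (layers n E \<beta> \<gamma> (k + d))) =
      mix n (\<beta>' (k' + d)) (\<lambda>r. a * phase E (\<gamma>' (k' + d)) (layers n E \<beta>' \<gamma>' (k' + d)) r)"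
    using Suc.prems(1,2)[of d] by (simp, intro mix_cong) (simp add: phase_def IH)
  then show ?case by (simp add: mix_scale)
qed

text \<open>The cost is diagonal, so even a phase depending on the basis state cancels against its
  conjugate.\<close>

lemma energy_cong:
  assumes "\<And>r. r < 2 ^ n \<Longrightarrow> layers n E \<beta> \<gamma> q r = a r * layers n E \<beta>' \<gamma>' q' r"
    and "\<And>r. norm (a r) = 1"
  shows "energy n E q \<beta> \<gamma> = energy n E q' \<beta>' \<gamma>'"
  unfolding energy_def
proof (rule sum.cong[OF refl])
  fix r assume "r \<in> {..<2 ^ n :: nat}"
  have "cnj (a r) * a r = 1"
    using assms(2)[of r] by (simp add: complex_norm_square[symmetric] mult.commute)
  with assms(1) \<open>r \<in> _\<close> show "cnj (layers n E \<beta> \<gamma> q r) * (of_real (cost E r) * layers n E \<beta> \<gamma> q r) =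
      cnj (layers n E \<beta>' \<gamma>' q' r) * (of_real (cost E r) * layers n E \<beta>' \<gamma>' q' r)" by simp
qed

lemma energy_shift:
  assumes "\<And>r. r < 2 ^ n \<Longrightarrow> layers n E \<beta> \<gamma> k r = a * layers n E \<beta>' \<gamma>' k' r" "norm a = 1"
    and "q = k + d" "q' = k' + d"
    and "\<And>l. l < d \<Longrightarrow> \<beta> (k + l) = \<beta>' (k' + l)" "\<And>l. l < d \<Longrightarrow> \<gamma> (k + l) = \<gamma>' (k' + l)"
  shows "energy n E q \<beta> \<gamma> = energy n E q' \<beta>' \<gamma>'"
  unfolding assms(3,4)
  by (rule energy_cong[where a = "\<lambda>_. a"]) (use assms layers_cong in blast)+

lemma layers_agree:
  assumes "\<And>l. l < k \<Longrightarrow> \<beta> l = \<beta>' l" "\<And>l. l < k \<Longrightarrow> \<gamma> l = \<gamma>' l"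
  shows "layers n E \<beta> \<gamma> k = layers n E \<beta>' \<gamma>' k"
  using assms by (induct k) auto

section \<open>Merging layers and inserting zero angles\<close>

text \<open>The trivial phase of layer \<open>Suc s\<close> makes the mixers of layers
  \<open>s\<close> and \<open>Suc s\<close> adjacent, so only the sum of their angles
  counts.\<close>

lemma energy_merge_beta:
  assumes "\<gamma> (Suc s) = 0" "Suc s < q" "\<And>k. k < q \<Longrightarrow> \<gamma>' k = \<gamma> k"
    "\<And>k. k < q \<Longrightarrow> k \<noteq> s \<Longrightarrow> k \<noteq> Suc s \<Longrightarrow> \<beta>' k = \<beta> k" "\<beta>' s + \<beta>' (Suc s) = \<beta> s + \<beta> (Suc s)"
  shows "energy n E q \<beta>' \<gamma>' = energy n E q \<beta> \<gamma>"
proof -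
  have "layers n E \<beta>' \<gamma>' s = layers n E \<beta> \<gamma> s"
    using assms by (intro layers_agree) auto
  then have "layers n E \<beta>' \<gamma>' (Suc (Suc s)) = layers n E \<beta> \<gamma> (Suc (Suc s))"
    using assms(1,2,5) assms(3)[of s] assms(3)[of "Suc s"] by (simp add: mix_mix add.commute)
  then show ?thesis
    using assms by (intro energy_shift[where a = 1 and k = "Suc (Suc s)" and k' = "Suc (Suc s)" and d = "q - Suc (Suc s)"]) auto
qed

text \<open>Here the trivial mixer of layer \<open>s\<close> makes the phases of layers
  \<open>s\<close> and \<open>Suc s\<close> adjacent.\<close>

lemma energy_merge_gamma:
  assumes "\<beta> s = 0" "Suc s < q" "\<And>k. k < q \<Longrightarrow> \<beta>' k = \<beta> k"
    "\<And>k. k < q \<Longrightarrow> k \<noteq> s \<Longrightarrow> k \<noteq> Suc s \<Longrightarrow> \<gamma>' k = \<gamma> k" "\<gamma>' s + \<gamma>' (Suc s) = \<gamma> s + \<gamma> (Suc s)"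
  shows "energy n E q \<beta>' \<gamma>' = energy n E q \<beta> \<gamma>"
proof -
  have *: "mix n b (phase E g (mix n 0 (phase E g' f))) = mix n b (phase E (g + g') f)" for b g g' f
    by (simp add: mix_0 phase_phase[symmetric] phase_def[of E g] cong: mix_cong)
  have "layers n E \<beta>' \<gamma>' s = layers n E \<beta> \<gamma> s"
    using assms by (intro layers_agree) auto
  then have "layers n E \<beta>' \<gamma>' (Suc (Suc s)) = layers n E \<beta> \<gamma> (Suc (Suc s))"
    using assms(1,2,5) assms(3)[of s] assms(3)[of "Suc s"] by (simp add: * add.commute)
  then show ?thesis
    using assms by (intro energy_shift[where a = 1 and k = "Suc (Suc s)" and k' = "Suc (Suc s)" and d = "q - Suc (Suc s)"]) auto
qed

text \<open>The first mixer acts directly on the uniform state and yields only a global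
  phase.\<close>

lemma energy_first_beta:
  assumes "\<gamma> 0 = 0" "0 < q" "\<And>k. k < q \<Longrightarrow> \<gamma>' k = \<gamma> k"
    "\<And>k. k < q \<Longrightarrow> k \<noteq> 0 \<Longrightarrow> \<beta>' k = \<beta> k"
  shows "energy n E q \<beta>' \<gamma>' = energy n E q \<beta> \<gamma>"
proof (rule energy_shift[where a = "cis (- (\<beta>' 0 - \<beta> 0) * mixer_eigenvalue n 0)" and k = 1 and k' = 1 and d = "q - 1"])
  show "layers n E \<beta>' \<gamma>' 1 r = cis (- (\<beta>' 0 - \<beta> 0) * mixer_eigenvalue n 0) * layers n E \<beta> \<gamma> 1 r" for r
    using assms(1,2) assms(3)[of 0] by (simp add: mix_uniform cis_mult algebra_simps flip: mult.assoc)
qed (use assms in auto)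

text \<open>The last phase operator is followed by a trivial mixer, and it commutes with the
  diagonal cost.\<close>

lemma energy_last_gamma:
  assumes "\<beta> s = 0" "\<And>k. k \<le> s \<Longrightarrow> \<beta>' k = \<beta> k" "\<And>k. k < s \<Longrightarrow> \<gamma>' k = \<gamma> k"
  shows "energy n E (Suc s) \<beta>' \<gamma>' = energy n E (Suc s) \<beta> \<gamma>"
proof (rule energy_cong[where a = "\<lambda>r. cis (- (\<gamma>' s - \<gamma> s) * cost E r)"])
  have "layers n E \<beta>' \<gamma>' s = layers n E \<beta> \<gamma> s"
    using assms by (intro layers_agree) auto
  then show "layers n E \<beta>' \<gamma>' (Suc s) r = cis (- (\<gamma>' s - \<gamma> s) * cost E r) * layers n E \<beta> \<gamma> (Suc s) r"
    if "r < 2 ^ n" for r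
    using assms(1) assms(2)[of s] that
    by (simp add: mix_0 phase_def cis_mult algebra_simps flip: mult.assoc)
qed simp

lemma energy_insert_same:
  assumes "s \<le> p" "\<beta>' s = 0" "\<gamma>' s = 0"
    "\<And>k. k < s \<Longrightarrow> \<beta>' k = \<beta> k" "\<And>k. s \<le> k \<Longrightarrow> k < p \<Longrightarrow> \<beta>' (Suc k) = \<beta> k"
    "\<And>k. k < s \<Longrightarrow> \<gamma>' k = \<gamma> k" "\<And>k. s \<le> k \<Longrightarrow> k < p \<Longrightarrow> \<gamma>' (Suc k) = \<gamma> k"
  shows "energy n E (Suc p) \<beta>' \<gamma>' = energy n E p \<beta> \<gamma>"
proof (rule energy_shift[where a = 1 and k = "Suc s" and k' = s and d = "p - s"])
  have "layers n E \<beta>' \<gamma>' s = layers n E \<beta> \<gamma> s"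
    using assms by (intro layers_agree) auto
  then show "layers n E \<beta>' \<gamma>' (Suc s) r = 1 * layers n E \<beta> \<gamma> s r" if "r < 2 ^ n" for r
    using assms(2,3) that by (simp add: mix_0)
qed (use assms in auto)

text \<open>The mixer of layer \<open>s\<close> and the phase of layer \<open>Suc s\<close> are
  trivial; what is left of these two layers is the old layer \<open>s\<close>.\<close>

lemma energy_insert_shifted:
  assumes "s < p" "\<beta>' s = 0" "\<gamma>' (Suc s) = 0"
    "\<And>k. k < s \<Longrightarrow> \<beta>' k = \<beta> k" "\<And>k. s \<le> k \<Longrightarrow> k < p \<Longrightarrow> \<beta>' (Suc k) = \<beta> k"
    "\<And>k. k \<le> s \<Longrightarrow> \<gamma>' k = \<gamma> k" "\<And>k. s < k \<Longrightarrow> k < p \<Longrightarrow> \<gamma>' (Suc k) = \<gamma> k"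
  shows "energy n E (Suc p) \<beta>' \<gamma>' = energy n E p \<beta> \<gamma>"
proof (rule energy_shift[where a = 1 and k = "Suc (Suc s)" and k' = "Suc s" and d = "p - Suc s"])
  have "layers n E \<beta>' \<gamma>' s = layers n E \<beta> \<gamma> s"
    using assms by (intro layers_agree) auto
  moreover have "mix n b (mix n 0 f) = mix n b f" for b f by (simp add: mix_mix)
  ultimately show "layers n E \<beta>' \<gamma>' (Suc (Suc s)) r = 1 * layers n E \<beta> \<gamma> (Suc s) r" for r
    using assms(2,3) assms(5)[of s] assms(6)[of s] assms(1) by simp
qed (use assms in auto)

section \<open>Inserting a zero layer\<close>

lemma length_insert_at: "length (insert_at i ys) = Suc (length ys)"
  by (simp add: insert_at_def)

lemma nth_insert_at:
  assumes "1 \<le> i" "i \<le> Suc (length ys)" "k \<le> length ys"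
  shows "insert_at i ys ! k = (if k < i - 1 then ys ! k else if k = i - 1 then 0 else ys ! (k - 1))"
  using assms by (auto simp: insert_at_def nth_append nth_Cons' min_def)

text \<open>The new position of the old coordinate \<open>k\<close> after an insertion at index
  \<open>s\<close>.\<close>

definition insert_index :: "nat \<Rightarrow> nat \<Rightarrow> nat" where
  "insert_index s k = (if k < s then k else Suc k)"

text \<open>Positions become zero-based here, and the \<gamma> block starts at \<open>p + 1\<close>
  because the \<beta> block has grown by one.\<close>

lemma ts_point_nth:
  assumes len: "length xs = 2 * p" and i: "1 \<le> i" "i \<le> p + 1" and j: "1 \<le> j" "j \<le> p + 1"
  shows "length (ts_point p xs i j) = 2 * (p + 1)"
    and "ts_point p xs i j ! (i - 1) = 0" "ts_point p xs i j ! (p + 1 + (j - 1)) = 0"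
    and "k < p \<Longrightarrow> ts_point p xs i j ! insert_index (i - 1) k = xs ! k"
    and "k < p \<Longrightarrow> ts_point p xs i j ! (p + 1 + insert_index (j - 1) k) = xs ! (p + k)"
  using assms
  by (auto simp: ts_point_def length_insert_at nth_append nth_insert_at insert_index_def)

theorem theorem2:
  fixes n p :: nat and E :: "(nat \<times> nat) set" and xs :: "real list" and i j :: nat
  assumes "n \<ge> 1"
    and "E \<subseteq> {(a, b). a < b \<and> b < n}"
    and "p \<ge> 1"
    and "local_min (qaoa_energy n E p) (2 * p) xs"
    and "1 \<le> i" and "i \<le> p + 1" and "j = i \<or> j = i + 1" and "j \<le> p + 1"
  shows "transition_state (qaoa_energy n E (p + 1)) (2 * (p + 1)) (ts_point p xs i j)
       \<or> det (hessian (qaoa_energy n E (p + 1)) (2 * (p + 1)) (ts_point p xs i j)) = 0"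
proof -
  define q where "q = p + 1"
  define s where "s = i - 1"
  define r where "r = j - 1"
  \<comment> \<open>\<open>b\<close> and \<open>g\<close> are the coordinates of the inserted
    \<beta> and \<gamma>.\<close>
  define b where "b = s"
  define g where "g = q + r"
  define x where "x = ts_point p xs i j"
  define en where "en u = energy n E q u (\<lambda>k. u (q + k))" for u :: "nat \<Rightarrow> real"
  have q_Suc: "q = Suc p" by (simp add: q_def)
  have len: "length xs = 2 * p" using assms(4) by (simp add: local_min_def)
  have sp: "s \<le> p" and j_cases: "r = s \<or> r = Suc s \<and> s < p"
    using assms(5-8) by (auto simp: s_def r_def)
  have jp: "r \<le> p" using assms(8) by (simp add: r_def)
  have j1: "1 \<le> j" using assms(5,7) by auto
  note x_nth = ts_point_nth[OF len assms(5,6) j1 assms(8), folded x_def s_def r_def q_def]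
  have b_ne: "b < q" "b < 2 * q" "g < 2 * q" "b \<noteq> g" using sp jp by (auto simp: b_def g_def q_def)

  obtain L where L: "\<And>u. en u = expsum (2 * q) L u"
    using trig_poly_energy[of q n E] unfolding trig_poly_def en_def by blast
  have F: "qaoa_energy n E (p + 1) ys = re_expsum (2 * q) L ((!) ys)" for ys
    unfolding L[symmetric] by (simp add: qaoa_energy_eq en_def q_def)

  \<comment> \<open>The zero phase lets the inserted \<beta> be traded against its predecessor if
    \<open>r = s\<close>, against its successor if \<open>r = Suc s\<close>; in the first layer it
    is absorbed by the uniform state.\<close>
  obtain v where v: "v b = 1" "v g = 0" "\<And>u t. u g = 0 \<Longrightarrow> en (\<lambda>a. u a + t * v a) = en u"
  proof -
    define e where "e k a = (if a = k then 1 else (0::real))" for k a :: nat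
    consider "r = s" "s = 0" | k where "r = s" "s = Suc k" | "r = Suc s" "s < p"
      using j_cases by (cases s) auto
    then show ?thesis
    proof cases
      case 1
      show ?thesis
      proof (rule that[of "e 0"])
        show "en (\<lambda>a. u a + t * e 0 a) = en u" if "u g = 0" for u t
          unfolding en_def
          by (rule energy_first_beta) (use that 1 in \<open>auto simp: e_def g_def q_def\<close>)
      qed (use 1 b_ne in \<open>auto simp: e_def b_def g_def\<close>)
    next
      case 2
      show ?thesis
      proof (rule that[of "\<lambda>a. e s a - e k a"])
        show "en (\<lambda>a. u a + t * (e s a - e k a)) = en u" if "u g = 0" for u t
          unfolding en_def
          by (rule energy_merge_beta[where s = k]) (use that 2 sp in \<open>auto simp: e_def g_def q_def\<close>)
      qed (use 2 b_ne in \<open>auto simp: e_def b_def g_def q_def\<close>)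
    next
      case 3
      show ?thesis
      proof (rule that[of "\<lambda>a. e s a - e (Suc s) a"])
        show "en (\<lambda>a. u a + t * (e s a - e (Suc s) a)) = en u" if "u g = 0" for u t
          unfolding en_def
          by (rule energy_merge_beta[where s = s]) (use that 3 in \<open>auto simp: e_def g_def q_def\<close>)
      qed (use 3 b_ne in \<open>auto simp: e_def b_def g_def q_def\<close>)
    qed
  qed

  \<comment> \<open>The zero mixer of layer \<open>s\<close> joins the phases \<open>s\<close> and
    \<open>Suc s\<close>. The inserted \<gamma> is the first of them if \<open>r = s\<close> and the
    second if \<open>r = Suc s\<close>, whence the two signs; in the last layer the cost absorbs
    it.\<close>
  obtain w where w: "w g = 1" "w b = 0" "\<And>u t. u b = 0 \<Longrightarrow> en (\<lambda>a. u a + t * w a) = en u"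
  proof -
    define e where "e k a = (if a = q + k then 1 else (0::real))" for k a :: nat
    consider "r = s" "s = p" | "r = s" "s < p" | "r = Suc s" "s < p"
      using j_cases sp by linarith
    then show ?thesis
    proof cases
      case 1
      show ?thesis
      proof (rule that[of "e p"])
        show "en (\<lambda>a. u a + t * e p a) = en u" if "u b = 0" for u t
          unfolding en_def
          by (subst (1 3) q_Suc, rule energy_last_gamma) (use that 1 in \<open>auto simp: e_def b_def q_def\<close>)
      qed (use 1 b_ne in \<open>auto simp: e_def b_def g_def q_def\<close>)
    next
      case 2
      show ?thesis
      proof (rule that[of "\<lambda>a. e s a - e (Suc s) a"])
        show "en (\<lambda>a. u a + t * (e s a - e (Suc s) a)) = en u" if "u b = 0" for u t
          unfolding en_def
          by (rule energy_merge_gamma[where s = s]) (use that 2 in \<open>auto simp: e_def b_def q_def\<close>)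
      qed (use 2 b_ne in \<open>auto simp: e_def b_def g_def q_def\<close>)
    next
      case 3
      show ?thesis
      proof (rule that[of "\<lambda>a. e (Suc s) a - e s a"])
        show "en (\<lambda>a. u a + t * (e (Suc s) a - e s a)) = en u" if "u b = 0" for u t
          unfolding en_def
          by (rule energy_merge_gamma[where s = s]) (use that 3 in \<open>auto simp: e_def b_def q_def\<close>)
      qed (use 3 b_ne in \<open>auto simp: e_def b_def g_def q_def\<close>)
    qed
  qed

  have insert: "en u = energy n E p \<beta> \<gamma>"
    if u: "u b = 0" "u g = 0" and \<beta>: "\<And>k. k < p \<Longrightarrow> u (insert_index s k) = \<beta> k"
      and \<gamma>: "\<And>k. k < p \<Longrightarrow> u (q + insert_index (r) k) = \<gamma> k" for u \<beta> \<gamma>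
  proof -
    have \<beta>'1: "u k = \<beta> k" if "k < p" "k < s" for k
      using \<beta>[OF that(1)] that(2) by (simp add: insert_index_def)
    have \<beta>'2: "u (Suc k) = \<beta> k" if "k < p" "s \<le> k" for k
      using \<beta>[OF that(1)] that(2) by (simp add: insert_index_def)
    have \<gamma>'1: "u (q + k) = \<gamma> k" if "k < p" "k < r" for k
      using \<gamma>[OF that(1)] that(2) by (simp add: insert_index_def)
    have \<gamma>'2: "u (q + Suc k) = \<gamma> k" if "k < p" "r \<le> k" for k
      using \<gamma>[OF that(1)] that(2) by (simp add: insert_index_def)
    note \<beta>' = \<beta>'1 \<beta>'2 and \<gamma>' = \<gamma>'1 \<gamma>'2[simplified]
    from j_cases show ?thesis
    proof
      assume js: "r = s"
      show ?thesis
        unfolding en_def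
        by (subst (1) q_Suc, rule energy_insert_same[where s = s]) (use u \<beta>' \<gamma>' sp js in \<open>auto simp: b_def g_def\<close>)
    next
      assume js: "r = Suc s \<and> s < p"
      show ?thesis
        unfolding en_def
        by (subst (1) q_Suc, rule energy_insert_shifted[where s = s]) (use u \<beta>' \<gamma>' js in \<open>auto simp: b_def g_def\<close>)
    qed
  qed

  have "\<exists>d>0. \<forall>t. \<bar>t\<bar> < d \<longrightarrow> Re (en ((!) x)) \<le> Re (en (\<lambda>a. x ! a + t * y a))"
    if y: "y b = 0" "y g = 0" for y
  proof -
    obtain d where d: "d > 0" "\<And>ys. length ys = 2 * p \<Longrightarrow>
        sqrt (\<Sum>a<2 * p. (ys ! a - xs ! a)^2) < d \<Longrightarrow> qaoa_energy n E p xs \<le> qaoa_energy n E p ys"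
      using assms(4) by (auto simp: local_min_def)
    \<comment> \<open>\<open>\<sigma>\<close> embeds the coordinates of the depth \<open>p\<close>
      circuit as those other than \<open>b\<close> and \<open>g\<close>, so the line through
      \<open>x\<close> pulls back to a line through the local minimum \<open>xs\<close>.\<close>
    define \<sigma> where "\<sigma> k = (if k < p then insert_index s k else q + insert_index (r) (k - p))" for k
    define ys where "ys t = map (\<lambda>k. xs ! k + t * y (\<sigma> k)) [0..<2 * p]" for t
    have x_zero: "x ! b = 0" "x ! g = 0"
      using x_nth(2,3) by (simp_all add: b_def g_def)
    have en_ys: "Re (en (\<lambda>a. x ! a + t * y a)) = qaoa_energy n E p (ys t)" for t
    proof -
      have "en (\<lambda>a. x ! a + t * y a) = energy n E p ((!) (ys t)) (\<lambda>k. ys t ! (p + k))"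
        by (rule insert)
           (use x_zero y x_nth(4,5) in \<open>auto simp: ys_def \<sigma>_def\<close>)
      then show ?thesis by (simp add: qaoa_energy_eq)
    qed
    define c where "c = sqrt (\<Sum>a<2 * p. (y (\<sigma> a))^2)"
    have dist: "sqrt (\<Sum>a<2 * p. (ys t ! a - xs ! a)^2) = \<bar>t\<bar> * c" for t
      by (simp add: ys_def c_def power_mult_distrib real_sqrt_mult flip: sum_distrib_left)
    have c: "c \<ge> 0" by (simp add: c_def sum_nonneg)
    have "ys 0 = xs" using map_nth[of xs] len by (simp add: ys_def)
    then have en_x: "Re (en ((!) x)) = qaoa_energy n E p xs" using en_ys[of 0] by simp
    show ?thesis
    proof (intro exI conjI allI impI)
      \<comment> \<open>\<open>c\<close> is the speed of the pulled-back line; \<open>c + 1\<close>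
        keeps the denominator positive when \<open>c = 0\<close>.\<close>
      show "d / (c + 1) > 0" using d(1) c by simp
      fix t assume t: "\<bar>t\<bar> < d / (c + 1)"
      have "\<bar>t\<bar> * c \<le> \<bar>t\<bar> * (c + 1)" by (intro mult_left_mono) auto
      also have "\<dots> < d" using t c by (simp add: field_simps)
      finally have "qaoa_energy n E p xs \<le> qaoa_energy n E p (ys t)"
        by (intro d(2)) (simp_all add: dist, simp add: ys_def)
      then show "Re (en ((!) x)) \<le> Re (en (\<lambda>a. x ! a + t * y a))"
        by (simp only: en_x en_ys)
    qed
  qed
  then have min: "\<exists>d>0. \<forall>t. \<bar>t\<bar> < d \<longrightarrow>
      re_expsum (2 * q) L ((!) x) \<le> re_expsum (2 * q) L (\<lambda>a. x ! a + t * y a)"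
    if "y b = 0" "y g = 0" for y
    using that by (simp only: L)
  have "transition_state (qaoa_energy n E (p + 1)) (2 * q) x \<or>
      det (hessian (qaoa_energy n E (p + 1)) (2 * q) x) = 0"
  proof (rule transition_state_or_singular[OF F _ b_ne(2-4) _ _ v(1,2) w(1,2) _ _ min])
    show "length x = 2 * q" "x ! b = 0" "x ! g = 0"
      using x_nth(1-3) by (simp_all add: b_def g_def)
    show "re_expsum (2 * q) L (\<lambda>a. u a + t * v a) = re_expsum (2 * q) L u" if "u g = 0" for u t
      using v(3)[of u t] that by (simp add: L)
    show "re_expsum (2 * q) L (\<lambda>a. u a + t * w a) = re_expsum (2 * q) L u" if "u b = 0" for u t
      using w(3)[of u t] that by (simp add: L)
  qed
  then show ?thesis by (simp add: x_def q_def)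
qed

end
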